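(* (i) Let $d \ge 3$ be odd and $n_1,\ldots,n_d$ positive integers. Then $$\delta(n_1,\ldots,n_d) \ge \left\lceil (n_1 \cdots n_d)^{1/(d-1)} \right\rceil.$$ (ii) Let $d > 3$, let $\ell \in [2, d-2]$ be an integer, and let $n_1,\ldots,n_d$ be positive integers such that $\delta(n_1,\ldots,n_\ell)$ and $\delta(n_{\ell+1},\ldots,n_d)$ are finite. Then $$\delta(n_1,\ldots,n_d) \le \mathrm{lcm}\big(\delta(n_1,\ldots,n_\ell),\ \delta(n_{\ell+1},\ldots,n_d)\big).$$
   Context: For positive integers $n_1,\ldots,n_r$, the group $\mathrm{SL}(n_1)\times\cdots\times\mathrm{SL}(n_r)$ acts on $\mathbb{C}^{n_1}\otimes\cdots\otimes\mathbb{C}^{n_r}$ by $(g_1,\ldots,g_r)\cdot(v_1\otimes\cdots\otimes v_r) = g_1v_1\otimes\cdots\otimes g_rv_r$, extended linearly. Define $\delta(n_1,\ldots,n_r)$ as the smallest positive integer $m$ such that there exists a nonzero invariant homogeneous polynomial of degree $m$ on this space (and $\infty$ if none exists). *)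

theory Defs
  imports
    Complex_Main
    "HOL-Library.Extended_Nat"
    "HOL-Library.Poly_Mapping"
    "Jordan_Normal_Form.Determinant"
begin

definition SL :: "nat \<Rightarrow> complex mat set" where
  "SL n = {A \<in> carrier_mat n n. det A = 1}"

definition SL_prod :: "nat list \<Rightarrow> complex mat list set" where
  "SL_prod ns = {gs. list_all2 (\<lambda>g n. g \<in> SL n) gs ns}"

text \<open>
  The tensor product of the spaces \<open>\<complex>\<^bsup>n\<^esup>\<close>, with \<open>n\<close> running through the list \<open>ns\<close>, is represented
  in coordinates with respect to the tensor products of standard basis vectors. Indices start at 0.
\<close>

definition multi_indices :: "nat list \<Rightarrow> nat list set" where
  "multi_indices ns = {is. list_all2 (<) is ns}"

type_synonym tensor = "nat list \<Rightarrow> complex"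

definition tensor_space :: "nat list \<Rightarrow> tensor set" where
  "tensor_space ns = {T. \<forall>is. is \<notin> multi_indices ns \<longrightarrow> T is = 0}"

definition pure_tensor :: "complex vec list \<Rightarrow> tensor" where
  "pure_tensor vs = (\<lambda>is. if is \<in> multi_indices (map dim_vec vs)
     then \<Prod>k<length vs. (vs ! k) $ (is ! k) else 0)"

text \<open>
  The linear action of a tuple of matrices on tensors. The lemmas \<open>tensor_act_pure\<close> and
  \<open>tensor_act_linear\<close> below show that this is the linear extension of
  \<open>v\<^sub>1 \<otimes> \<dots> \<otimes> v\<^sub>r \<mapsto> g\<^sub>1 v\<^sub>1 \<otimes> \<dots> \<otimes> g\<^sub>r v\<^sub>r\<close>.
\<close>

definition tensor_act :: "nat list \<Rightarrow> complex mat list \<Rightarrow> tensor \<Rightarrow> tensor" where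
  "tensor_act ns gs T = (\<lambda>is. if is \<in> multi_indices ns
     then \<Sum>js\<in>multi_indices ns. (\<Prod>k<length ns. (gs ! k) $$ (is ! k, js ! k)) * T js else 0)"

text \<open>
  Polynomials over the complex numbers in variables indexed by \<open>'v\<close>, as finitely supported families
  of coefficients; a monomial is the finitely supported family of its exponents.
\<close>

type_synonym 'v mpolynomial = "('v \<Rightarrow>\<^sub>0 nat) \<Rightarrow>\<^sub>0 complex"

definition poly_vars :: "'v mpolynomial \<Rightarrow> 'v set" where
  "poly_vars p = (\<Union>m\<in>Poly_Mapping.keys p. Poly_Mapping.keys m)"

definition poly_eval :: "'v mpolynomial \<Rightarrow> ('v \<Rightarrow> complex) \<Rightarrow> complex" where
  "poly_eval p x = (\<Sum>m\<in>Poly_Mapping.keys p. Poly_Mapping.lookup p m *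
     (\<Prod>i\<in>Poly_Mapping.keys m. x i ^ Poly_Mapping.lookup m i))"

definition monom_degree :: "('v \<Rightarrow>\<^sub>0 nat) \<Rightarrow> nat" where
  "monom_degree m = (\<Sum>i\<in>Poly_Mapping.keys m. Poly_Mapping.lookup m i)"

definition homogeneous_poly :: "nat \<Rightarrow> 'v mpolynomial \<Rightarrow> bool" where
  "homogeneous_poly d p \<longleftrightarrow> (\<forall>m\<in>Poly_Mapping.keys p. monom_degree m = d)"

definition invariant_poly :: "nat list \<Rightarrow> nat list mpolynomial \<Rightarrow> bool" where
  "invariant_poly ns p \<longleftrightarrow> poly_vars p \<subseteq> multi_indices ns \<and>
     (\<forall>gs\<in>SL_prod ns. \<forall>T\<in>tensor_space ns. poly_eval p (tensor_act ns gs T) = poly_eval p T)"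

text \<open>The infimum of the empty set in \<^typ>\<open>enat\<close> is \<open>\<infinity>\<close>.\<close>

definition delta :: "nat list \<Rightarrow> enat" where
  "delta ns = Inf {enat m |m. 0 < m \<and>
     (\<exists>p. p \<noteq> 0 \<and> homogeneous_poly m p \<and> invariant_poly ns p)}"

lemma multi_indices_Nil: "multi_indices [] = {[]}"
  by (auto simp: multi_indices_def)

lemma multi_indices_Cons:
  "multi_indices (n # ns) = (\<lambda>(i, is). i # is) ` ({..<n} \<times> multi_indices ns)"
  by (auto simp: multi_indices_def list_all2_Cons2)

lemma finite_multi_indices: "finite (multi_indices ns)"
  by (induction ns) (auto simp: multi_indices_Nil multi_indices_Cons)

lemma sum_prod_multi_indices:
  fixes f :: "nat \<Rightarrow> nat \<Rightarrow> complex"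
  shows "(\<Sum>js\<in>multi_indices ns. \<Prod>k<length ns. f k (js ! k)) =
    (\<Prod>k<length ns. \<Sum>j<ns ! k. f k j)"
proof (induction ns arbitrary: f)
  case Nil
  then show ?case by (simp add: multi_indices_Nil)
next
  case (Cons n ns)
  have "(\<Sum>js\<in>multi_indices (n # ns). \<Prod>k<length (n # ns). f k (js ! k)) =
      (\<Sum>(j, js)\<in>{..<n} \<times> multi_indices ns. f 0 j * (\<Prod>k<length ns. f (Suc k) (js ! k)))"
    unfolding multi_indices_Cons
    by (subst sum.reindex)
      (auto simp: inj_on_def prod.lessThan_Suc_shift simp del: prod.lessThan_Suc intro!: sum.cong)
  also have "\<dots> = (\<Sum>j<n. f 0 j) * (\<Sum>js\<in>multi_indices ns. \<Prod>k<length ns. f (Suc k) (js ! k))"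
    by (simp add: sum_product sum.cartesian_product)
  also have "\<dots> = (\<Prod>k<length (n # ns). \<Sum>j<(n # ns) ! k. f k j)"
    by (simp add: Cons.IH[of "\<lambda>k. f (Suc k)"] prod.lessThan_Suc_shift del: prod.lessThan_Suc)
  finally show ?case .
qed

lemma tensor_act_pure:
  assumes "list_all2 (\<lambda>g n. g \<in> carrier_mat n n) gs ns"
    and "list_all2 (\<lambda>v n. v \<in> carrier_vec n) vs ns"
  shows "tensor_act ns gs (pure_tensor vs) = pure_tensor (map2 (*\<^sub>v) gs vs)"
proof
  fix "is"
  have len: "length gs = length ns" "length vs = length ns"
    using assms by (auto dest: list_all2_lengthD)
  have g: "gs ! k \<in> carrier_mat (ns ! k) (ns ! k)" and v: "vs ! k \<in> carrier_vec (ns ! k)"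
    if "k < length ns" for k
    using assms that len by (auto dest: list_all2_nthD2)
  have dims: "map dim_vec vs = ns" "map dim_vec (map2 (*\<^sub>v) gs vs) = ns"
    using carrier_matD(1)[OF g] carrier_vecD[OF v] len by (auto intro!: nth_equalityI)
  show "tensor_act ns gs (pure_tensor vs) is = pure_tensor (map2 (*\<^sub>v) gs vs) is"
  proof (cases "is \<in> multi_indices ns")
    case True
    then have i: "is ! k < ns ! k" if "k < length ns" for k
      using that by (auto simp: multi_indices_def dest: list_all2_nthD2)
    have "tensor_act ns gs (pure_tensor vs) is = (\<Sum>js\<in>multi_indices ns.
        \<Prod>k<length ns. (gs ! k) $$ (is ! k, js ! k) * (vs ! k) $ (js ! k))"
      using True by (simp add: tensor_act_def pure_tensor_def dims len prod.distrib)
    also have "\<dots> = (\<Prod>k<length ns. \<Sum>j<ns ! k. (gs ! k) $$ (is ! k, j) * (vs ! k) $ j)"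
      by (rule sum_prod_multi_indices)
    also have "\<dots> = (\<Prod>k<length ns. (gs ! k *\<^sub>v vs ! k) $ (is ! k))"
    proof (rule prod.cong)
      fix k assume "k \<in> {..<length ns}"
      then show "(\<Sum>j<ns ! k. (gs ! k) $$ (is ! k, j) * (vs ! k) $ j) =
          (gs ! k *\<^sub>v vs ! k) $ (is ! k)"
        using g[of k] v[of k] i[of k] by (auto simp: scalar_prod_def lessThan_atLeast0)
    qed simp
    also have "\<dots> = pure_tensor (map2 (*\<^sub>v) gs vs) is"
      unfolding pure_tensor_def dims using True len by simp
    finally show ?thesis .
  next
    case False
    then show ?thesis unfolding tensor_act_def pure_tensor_def dims by simp
  qed
qed

lemma tensor_act_linear:
  "tensor_act ns gs (\<lambda>is. a * S is + b * T is) =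
    (\<lambda>is. a * tensor_act ns gs S is + b * tensor_act ns gs T is)"
  by (auto simp: tensor_act_def algebra_simps sum.distrib sum_distrib_left)

end

theory Submission
  imports
    Defs
    "HOL-Library.FuncSet"
    "HOL-Combinatorics.Permutations"
    "Jordan_Normal_Form.Char_Poly"
begin

text \<open>
  Lower bound. Let \<open>f\<close> be an invariant of degree \<open>m\<close>. Scalar matrices show that each \<open>n\<^sub>k\<close> divides
  \<open>m\<close>, say \<open>m = r\<^sub>k n\<^sub>k\<close>, and \<open>f(gT) = (\<Prod>\<^sub>k det(g\<^sub>k)\<^bsup>r\<^sub>k\<^esup>) f(T)\<close> holds for all tuples of matrices.
  Applying the powers \<open>\<Omega>\<^bsup>r\<^sub>k\<^esup>\<close> of Cayley's operators in all \<open>g\<^sub>k\<close> turns the right-hand side into a nonzero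
  multiple of \<open>f(T)\<close>, and the left-hand side into a sum of terms which, for each \<open>k\<close>, are alternating
  in the blocks of a partition of the \<open>m\<close> positions of a monomial into \<open>r\<^sub>k\<close> blocks. If
  \<open>m > \<Prod>\<^sub>k r\<^sub>k\<close>, two positions lie in a common block for every \<open>k\<close>; swapping them changes the sign
  \<open>d\<close> times, and since \<open>d\<close> is odd, everything cancels and \<open>f = 0\<close>. So \<open>m \<le> \<Prod>\<^sub>k (m / n\<^sub>k)\<close>.

  Upper bound. Suitable powers of two invariants have the same degree \<open>m\<close>, the least common multiple.
  If \<open>P\<close> and \<open>Q\<close> are the polarizations of these powers, then \<open>P \<otimes> Q\<close> restricted to the diagonal is an
  invariant of degree \<open>m\<close>, which takes a nonzero value at a suitable \<open>v \<otimes> w\<close>.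
\<close>

section \<open>Forms and polarization\<close>

text \<open>Extensional functions, so that sums over all sign vectors factor by
  \<open>prod_sum_PiE\<close>.\<close>

definition signs :: "nat \<Rightarrow> (nat \<Rightarrow> complex) set" where
  "signs m = {..<m} \<rightarrow>\<^sub>E {-1, 1}"

lemma finite_signs [simp]: "finite (signs m)"
  by (auto simp: signs_def intro!: finite_PiE)

text \<open>Grouping the positions by their image, the sum factors into one sum of
  \<open>y ^ (1 + c i)\<close> over \<open>y = -1, 1\<close> for each \<open>i\<close>. A fibre of
  size 1 gives 2, an empty one gives 0, and every self-map that is not bijective has an empty
  fibre.\<close>

lemma sum_signs_prod:
  assumes \<phi>: "\<phi> ` {..<m} \<subseteq> {..<m}"
  shows "(\<Sum>s\<in>signs m. (\<Prod>j<m. s j) * (\<Prod>j<m. s (\<phi> j))) =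
    (if bij_betw \<phi> {..<m} {..<m} then 2 ^ m else 0)"
proof -
  define c where "c i = card {j \<in> {..<m}. \<phi> j = i}" for i
  have "(\<Prod>j<m. s j) * (\<Prod>j<m. s (\<phi> j)) = (\<Prod>i<m. s i ^ (1 + c i))" for s :: "nat \<Rightarrow> complex"
  proof -
    have "(\<Prod>j<m. s (\<phi> j)) = (\<Prod>i<m. \<Prod>j | j \<in> {..<m} \<and> \<phi> j = i. s (\<phi> j))"
      by (rule prod.group[symmetric]) (use \<phi> in auto)
    also have "\<dots> = (\<Prod>i<m. s i ^ c i)"
    proof (intro prod.cong refl)
      fix i
      have "(\<Prod>j | j \<in> {..<m} \<and> \<phi> j = i. s (\<phi> j)) = (\<Prod>j | j \<in> {..<m} \<and> \<phi> j = i. s i)"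
        by (rule prod.cong) auto
      then show "(\<Prod>j | j \<in> {..<m} \<and> \<phi> j = i. s (\<phi> j)) = s i ^ c i" by (simp add: c_def)
    qed
    finally show ?thesis by (simp add: prod.distrib)
  qed
  then have "(\<Sum>s\<in>signs m. (\<Prod>j<m. s j) * (\<Prod>j<m. s (\<phi> j))) =
      (\<Sum>s\<in>signs m. \<Prod>i<m. s i ^ (1 + c i))" by simp
  also have "\<dots> = (\<Prod>i<m. \<Sum>y\<in>{-1, 1::complex}. y ^ (1 + c i))"
    unfolding signs_def by (rule prod_sum_PiE[symmetric]) auto
  also have "\<dots> = (if bij_betw \<phi> {..<m} {..<m} then 2 ^ m else 0)"
  proof (cases "bij_betw \<phi> {..<m} {..<m}")
    case True
    have "c i = 1" if "i < m" for i
    proof -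
      from True that obtain j where "j < m" "\<phi> j = i"
        by (metis bij_betw_def imageE lessThan_iff)
      then have "{j \<in> {..<m}. \<phi> j = i} = {j}"
        using True by (auto simp: bij_betw_def inj_on_def)
      then show ?thesis by (simp add: c_def)
    qed
    then show ?thesis using True by simp
  next
    case False
    then have "\<phi> ` {..<m} \<noteq> {..<m}"
      by (metis bij_betw_def eq_card_imp_inj_on finite_lessThan)
    then obtain i where i: "i < m" "i \<notin> \<phi> ` {..<m}" using \<phi> by auto
    then have "c i = 0" by (auto simp: c_def)
    then have "(\<Sum>y\<in>{-1, 1::complex}. y ^ (1 + c i)) = 0" by simp
    then show ?thesis using False i(1) by (auto intro!: prod_zero)
  qed
  finally show ?thesis .
qed

text \<open>Glynn's formula for the permanent.\<close>

lemma sum_signs_prod_sum: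
  fixes x :: "nat \<Rightarrow> nat \<Rightarrow> complex"
  shows "(\<Sum>s\<in>signs m. (\<Prod>j<m. s j) * (\<Prod>j<m. \<Sum>i<m. s i * x i j)) =
    2 ^ m * (\<Sum>\<phi> | \<phi> permutes {..<m}. \<Prod>j<m. x (\<phi> j) j)"
proof -
  let ?F = "{..<m} \<rightarrow>\<^sub>E {..<m}"
  have "(\<Sum>s\<in>signs m. (\<Prod>j<m. s j) * (\<Prod>j<m. \<Sum>i<m. s i * x i j)) =
      (\<Sum>s\<in>signs m. \<Sum>\<phi>\<in>?F. ((\<Prod>j<m. s j) * (\<Prod>j<m. s (\<phi> j))) * (\<Prod>j<m. x (\<phi> j) j))"
    by (subst prod_sum_PiE) (auto simp: sum_distrib_left prod.distrib mult.assoc)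
  also have "\<dots> = (\<Sum>\<phi>\<in>?F. (\<Sum>s\<in>signs m. (\<Prod>j<m. s j) * (\<Prod>j<m. s (\<phi> j))) * (\<Prod>j<m. x (\<phi> j) j))"
    by (subst sum.swap) (simp add: sum_distrib_right)
  also have "\<dots> = (\<Sum>\<phi>\<in>?F. (if bij_betw \<phi> {..<m} {..<m} then 2 ^ m else 0) * (\<Prod>j<m. x (\<phi> j) j))"
    by (intro sum.cong refl, subst sum_signs_prod) auto
  also have "\<dots> = (\<Sum>\<phi>\<in>{\<phi>\<in>?F. bij_betw \<phi> {..<m} {..<m}}. 2 ^ m * (\<Prod>j<m. x (\<phi> j) j))"
    by (rule sum.mono_neutral_cong_right) (auto intro!: finite_PiE)
  \<comment> \<open>The index changes from extensional bijections, undefined outside, to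
    \<open>permutes\<close>, which fixes all points outside.\<close>
  also have "\<dots> = (\<Sum>\<phi> | \<phi> permutes {..<m}. 2 ^ m * (\<Prod>j<m. x (\<phi> j) j))"
  proof (rule sum.reindex_bij_witness[where i="\<lambda>\<phi>. restrict \<phi> {..<m}" and
        j="\<lambda>\<phi> j. if j < m then \<phi> j else j"])
    fix \<phi> assume \<phi>: "\<phi> \<in> {\<phi>\<in>?F. bij_betw \<phi> {..<m} {..<m}}"
    then have "bij_betw (\<lambda>j. if j < m then \<phi> j else j) {..<m} {..<m}"
      by (subst bij_betw_cong[where g=\<phi>]) auto
    then show "(\<lambda>j. if j < m then \<phi> j else j) \<in> {\<phi>. \<phi> permutes {..<m}}"
      by (auto intro!: bij_imp_permutes split: if_splits)
    have "\<phi> \<in> extensional {..<m}" using \<phi> by (simp add: PiE_iff)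
    then show "restrict (\<lambda>j. if j < m then \<phi> j else j) {..<m} = \<phi>"
      by (auto simp: extensional_def restrict_def)
    show "2 ^ m * (\<Prod>j<m. x (if j < m then \<phi> j else j) j) = 2 ^ m * (\<Prod>j<m. x (\<phi> j) j)"
      by simp
  next
    fix \<phi> assume "\<phi> \<in> {\<phi>. \<phi> permutes {..<m}}"
    then have \<phi>: "\<phi> permutes {..<m}" by simp
    have "bij_betw (restrict \<phi> {..<m}) {..<m} {..<m}"
      using permutes_imp_bij[OF \<phi>] by (subst bij_betw_cong[where g=\<phi>]) auto
    then show "restrict \<phi> {..<m} \<in> {\<phi>\<in>?F. bij_betw \<phi> {..<m} {..<m}}"
      by (auto simp: bij_betw_def)
    show "(\<lambda>j. if j < m then restrict \<phi> {..<m} j else j) = \<phi>"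
      using permutes_not_in[OF \<phi>] by (auto simp: fun_eq_iff)
  qed
  finally show ?thesis by (simp add: sum_distrib_left)
qed

text \<open>Homogeneous polynomials of degree \<open>m\<close> as functions. A monomial is a word of
  \<open>m\<close> variables, whose letters can be permuted by position, and induction adds one
  monomial at a time.\<close>

inductive form :: "nat \<Rightarrow> 'v set \<Rightarrow> (('v \<Rightarrow> complex) \<Rightarrow> complex) \<Rightarrow> bool" for m V where
  zero: "form m V (\<lambda>x. 0)"
| add_monomial: "form m V (\<lambda>x. c * prod_list (map x xs) + f x)"
    if "form m V f" "length xs = m" "set xs \<subseteq> V"

lemma form_monomial: "length xs = m \<Longrightarrow> set xs \<subseteq> V \<Longrightarrow> form m V (\<lambda>x. c * prod_list (map x xs))"
  using form.add_monomial[OF form.zero, of xs m V c] by simp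

lemma form_add: "form m V f \<Longrightarrow> form m V g \<Longrightarrow> form m V (\<lambda>x. f x + g x)"
  by (induction rule: form.induct) (auto simp: add.assoc intro: form.add_monomial)

lemma form_sum:
  "(\<And>i. i \<in> S \<Longrightarrow> form m V (f i)) \<Longrightarrow> form m V (\<lambda>x. \<Sum>i\<in>S. f i x)"
  by (induction S rule: infinite_finite_induct) (auto intro: form.zero form_add)

lemma form_mult:
  assumes "form m V f" "form k V g"
  shows "form (m + k) V (\<lambda>x. f x * g x)"
  using assms(1)
proof (induction rule: form.induct)
  case zero
  show ?case by (simp add: form.zero)
next
  case (add_monomial f xs c)
  have "form (m + k) V (\<lambda>x. c * prod_list (map x xs) * g x)"
    using assms(2)
  proof (induction rule: form.induct)
    case zero
    show ?case by (simp add: form.zero)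
  next
    case (add_monomial g ys b)
    then show ?case
      using \<open>length xs = m\<close> \<open>set xs \<subseteq> V\<close>
        form.add_monomial[of "m + k" V _ "xs @ ys" "c * b"]
      by (auto simp: algebra_simps)
  qed
  from form_add[OF this add_monomial.IH] show ?case by (simp add: algebra_simps)
qed

lemma form_power: "form m V f \<Longrightarrow> form (m * k) V (\<lambda>x. f x ^ k)"
proof (induction k)
  case 0
  show ?case using form_monomial[of "[]" 0 V 1] by simp
next
  case (Suc k)
  then show ?case using form_mult[of m V f "m * k" "\<lambda>x. f x ^ k"] by simp
qed

lemma form_scale:
  assumes "form m V f"
  shows "f (\<lambda>i. a * x i) = a ^ m * f x"
  using assms
proof (induction rule: form.induct)
  case (add_monomial f xs c)
  have "prod_list (map (\<lambda>i. a * x i) xs) = a ^ length xs * prod_list (map x xs)"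
    by (induction xs) (auto simp: algebra_simps)
  with add_monomial show ?case by (simp add: algebra_simps)
qed simp

lemma form_tendsto:
  assumes "form m V f" "\<And>i. ((\<lambda>t. y t i) \<longlongrightarrow> y0 i) F"
  shows "((\<lambda>t. f (y t)) \<longlongrightarrow> f y0) F"
  using assms(1)
proof (induction rule: form.induct)
  case (add_monomial f xs c)
  have "((\<lambda>t. prod_list (map (y t) xs)) \<longlongrightarrow> prod_list (map y0 xs)) F"
    by (induction xs) (auto intro!: tendsto_intros assms(2))
  with add_monomial show ?case by (auto intro!: tendsto_intros)
qed simp

section \<open>Polarization as a signed sum of point evaluations\<close>

lemma prod_list_map_nth: "prod_list (map x xs) = (\<Prod>j<length xs. x (xs ! j) :: 'a::comm_monoid_mult)"
  by (simp add: prod.list_conv_set_nth lessThan_atLeast0)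

text \<open>For a form of degree \<open>m\<close> this is \<open>2 ^ m * fact m\<close> times the
  symmetric multilinear form that restricts to \<open>f\<close> on the diagonal. Since only values
  of \<open>f\<close> occur, invariance of \<open>f\<close> passes to it directly.\<close>

definition polarization ::
  "nat \<Rightarrow> (('v \<Rightarrow> complex) \<Rightarrow> complex) \<Rightarrow> (nat \<Rightarrow> 'v \<Rightarrow> complex) \<Rightarrow> complex" where
  "polarization m f v = (\<Sum>s\<in>signs m. (\<Prod>j<m. s j) * f (\<lambda>x. \<Sum>i<m. s i * v i x))"

lemma polarization_zero [simp]: "polarization m (\<lambda>x. 0) v = 0"
  by (simp add: polarization_def)

lemma polarization_add:
  "polarization m (\<lambda>x. f x + g x) v = polarization m f v + polarization m g v"
  by (simp add: polarization_def algebra_simps sum.distrib)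

lemma polarization_monomial:
  assumes "length xs = m"
  shows "polarization m (\<lambda>x. c * prod_list (map x xs)) v =
    c * 2 ^ m * (\<Sum>\<phi> | \<phi> permutes {..<m}. \<Prod>j<m. v (\<phi> j) (xs ! j))"
proof -
  have "polarization m (\<lambda>x. c * prod_list (map x xs)) v =
    c * (\<Sum>s\<in>signs m. (\<Prod>j<m. s j) * (\<Prod>j<m. \<Sum>i<m. s i * v i (xs ! j)))"
    using assms by (simp add: polarization_def prod_list_map_nth sum_distrib_left mult.left_commute)
  then show ?thesis
    using sum_signs_prod_sum[of m "\<lambda>i j. v i (xs ! j)"] by (simp add: algebra_simps)
qed

lemma polarization_diag:
  assumes "form m V f"
  shows "polarization m f (\<lambda>_. x) = 2 ^ m * fact m * f x"
  using assms
proof (induction rule: form.induct)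
  case (add_monomial f xs c)
  then show ?case
    by (simp add: polarization_add polarization_monomial card_permutations algebra_simps)
      (simp add: prod_list_map_nth)
qed simp

text \<open>Makes the coefficients \<open>A\<close> of the multilinear form available, so that those
  of two forms can be multiplied later. By linearity one word suffices.\<close>

lemma polarization_multilinear:
  assumes "form m V f" "finite V"
  obtains A where "\<And>v. polarization m f v = (\<Sum>X\<in>{..<m} \<rightarrow>\<^sub>E V. A X * (\<Prod>i<m. v i (X i)))"
proof -
  have "\<exists>A. \<forall>v. polarization m f v = (\<Sum>X\<in>{..<m} \<rightarrow>\<^sub>E V. A X * (\<Prod>i<m. v i (X i)))"
    using assms(1)
  proof (induction rule: form.induct)
    case zero
    show ?case by (intro exI[of _ "\<lambda>_. 0"]) simp
  next
    case (add_monomial f xs c)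
    then obtain A where
      A: "\<And>v. polarization m f v = (\<Sum>X\<in>{..<m} \<rightarrow>\<^sub>E V. A X * (\<Prod>i<m. v i (X i)))" by blast
    \<comment> \<open>Letter \<open>j\<close> goes to argument \<open>\<phi> j\<close>, so argument
      \<open>i\<close> receives the letter at the preimage of \<open>i\<close> under
      \<open>\<phi>\<close>; \<open>N X\<close> counts the permutations producing the index
      \<open>X\<close>.\<close>
    let ?W = "\<lambda>\<phi>. restrict (\<lambda>i. xs ! Hilbert_Choice.inv \<phi> i) {..<m}"
    define N :: "(nat \<Rightarrow> 'a) \<Rightarrow> complex" where
      "N X = (\<Sum>\<phi> | \<phi> permutes {..<m}. of_bool (X = ?W \<phi>))" for X
    define B where "B X = A X + c * 2 ^ m * N X" for X
    have "polarization m (\<lambda>x. c * prod_list (map x xs) + f x) v =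
      (\<Sum>X\<in>{..<m} \<rightarrow>\<^sub>E V. B X * (\<Prod>i<m. v i (X i)))" for v
    proof -
      have "(\<Prod>j<m. v (\<phi> j) (xs ! j)) =
          (\<Sum>X\<in>{..<m} \<rightarrow>\<^sub>E V. of_bool (X = ?W \<phi>) * (\<Prod>i<m. v i (X i)))"
        if \<phi>: "\<phi> permutes {..<m}" for \<phi>
      proof -
        have "?W \<phi> \<in> {..<m} \<rightarrow>\<^sub>E V"
        proof
          fix i assume "i \<in> {..<m}"
          then have "Hilbert_Choice.inv \<phi> i < length xs"
            using permutes_in_image[OF permutes_inv[OF \<phi>]] add_monomial.hyps by auto
          then show "?W \<phi> i \<in> V" using \<open>i \<in> {..<m}\<close> add_monomial.hyps by auto
        qed auto
        then have "(\<Sum>X\<in>{..<m} \<rightarrow>\<^sub>E V. of_bool (X = ?W \<phi>) * (\<Prod>i<m. v i (X i))) =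
            (\<Prod>i<m. v i (?W \<phi> i))"
          using assms(2) by (simp add: of_bool_def if_distrib[where f="\<lambda>x. x * _"] finite_PiE
              sum.delta cong: if_cong)
        also have "\<dots> = (\<Prod>j<m. v (\<phi> j) (?W \<phi> (\<phi> j)))"
          by (rule prod.permute[OF \<phi>, unfolded comp_def])
        also have "\<dots> = (\<Prod>j<m. v (\<phi> j) (xs ! j))"
          using permutes_in_image[OF \<phi>] by (intro prod.cong) (auto simp: permutes_inverses[OF \<phi>])
        finally show ?thesis ..
      qed
      then have "(\<Sum>\<phi> | \<phi> permutes {..<m}. \<Prod>j<m. v (\<phi> j) (xs ! j)) =
          (\<Sum>X\<in>{..<m} \<rightarrow>\<^sub>E V. N X * (\<Prod>i<m. v i (X i)))"
        unfolding N_def sum_distrib_right by (subst sum.swap) simp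
      then show ?thesis
        using add_monomial.hyps
        unfolding polarization_add A polarization_monomial[OF add_monomial.hyps(2)] B_def
          distrib_right sum.distrib
        by (simp add: sum_distrib_left mult.assoc add.commute)
    qed
    then show ?case by blast
  qed
  then show ?thesis using that by blast
qed

section \<open>Forms and formal polynomials\<close>

definition eval_monomial :: "('v \<Rightarrow> complex) \<Rightarrow> ('v \<Rightarrow>\<^sub>0 nat) \<Rightarrow> complex" where
  "eval_monomial x \<alpha> = (\<Prod>i\<in>Poly_Mapping.keys \<alpha>. x i ^ Poly_Mapping.lookup \<alpha> i)"

definition monomial_of :: "'v list \<Rightarrow> ('v \<Rightarrow>\<^sub>0 nat)" where
  "monomial_of xs = sum_list (map (\<lambda>x. Poly_Mapping.single x 1) xs)"

lemma monomial_of_simps [simp]: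
  "monomial_of [] = 0"
  "monomial_of (x # xs) = Poly_Mapping.single x 1 + monomial_of xs"
  by (simp_all add: monomial_of_def)

lemma lookup_monomial_of: "Poly_Mapping.lookup (monomial_of xs) i = count (mset xs) i"
  by (induction xs) (auto simp: lookup_add lookup_single when_def)

lemma monomial_of_eq_iff: "monomial_of xs = monomial_of ys \<longleftrightarrow> mset xs = mset ys"
  by (metis lookup_monomial_of multiset_eqI poly_mapping_eqI)

lemma keys_monomial_of: "Poly_Mapping.keys (monomial_of xs) = set xs"
  by (auto simp: in_keys_iff lookup_monomial_of count_eq_zero_iff)

lemma ex_monomial_of: "\<exists>xs. monomial_of xs = \<alpha>"
proof -
  obtain xs where xs: "mset xs = (\<Sum>i\<in>Poly_Mapping.keys \<alpha>. replicate_mset (Poly_Mapping.lookup \<alpha> i) i)"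
    using ex_mset by blast
  have "count (mset xs) i = Poly_Mapping.lookup \<alpha> i" for i
    unfolding xs by (auto simp: count_sum sum.delta' in_keys_iff if_distrib cong: if_cong)
  then show ?thesis
    by (intro exI[of _ xs] poly_mapping_eqI) (simp add: lookup_monomial_of)
qed

lemma eval_monomial_superset:
  assumes "finite S" "Poly_Mapping.keys \<alpha> \<subseteq> S"
  shows "eval_monomial x \<alpha> = (\<Prod>i\<in>S. x i ^ Poly_Mapping.lookup \<alpha> i)"
  unfolding eval_monomial_def
  using assms by (intro prod.mono_neutral_left) (auto simp: in_keys_iff)

lemma eval_monomial_add: "eval_monomial x (\<alpha> + \<beta>) = eval_monomial x \<alpha> * eval_monomial x \<beta>"
proof -
  let ?S = "Poly_Mapping.keys \<alpha> \<union> Poly_Mapping.keys \<beta>"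
  show ?thesis
    using Poly_Mapping.keys_add[of \<alpha> \<beta>]
    by (simp add: eval_monomial_superset[of ?S] lookup_add power_add prod.distrib)
qed

lemma eval_monomial_of: "eval_monomial x (monomial_of xs) = prod_list (map x xs)"
  by (induction xs) (auto simp: eval_monomial_add, auto simp: eval_monomial_def)

lemma monom_degree_add: "monom_degree (\<alpha> + \<beta>) = monom_degree \<alpha> + monom_degree \<beta>"
proof -
  let ?S = "Poly_Mapping.keys \<alpha> \<union> Poly_Mapping.keys \<beta>"
  have *: "monom_degree \<gamma> = (\<Sum>i\<in>?S. Poly_Mapping.lookup \<gamma> i)"
    if "Poly_Mapping.keys \<gamma> \<subseteq> ?S" for \<gamma>
    unfolding monom_degree_def using that
    by (intro sum.mono_neutral_left) (auto simp: in_keys_iff)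
  show ?thesis
    using Poly_Mapping.keys_add[of \<alpha> \<beta>] by (simp add: * lookup_add sum.distrib)
qed

lemma monom_degree_monomial_of: "monom_degree (monomial_of xs) = length xs"
  by (induction xs) (auto simp: monom_degree_add, auto simp: monom_degree_def)

lemma poly_eval_superset:
  assumes "finite S" "Poly_Mapping.keys p \<subseteq> S"
  shows "poly_eval p x = (\<Sum>\<alpha>\<in>S. Poly_Mapping.lookup p \<alpha> * eval_monomial x \<alpha>)"
  unfolding poly_eval_def eval_monomial_def
  using assms by (intro sum.mono_neutral_left) (auto simp: in_keys_iff)

lemma poly_eval_add: "poly_eval (p + q) x = poly_eval p x + poly_eval q x"
proof -
  let ?S = "Poly_Mapping.keys p \<union> Poly_Mapping.keys q"
  show ?thesis
    using Poly_Mapping.keys_add[of p q]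
    by (simp add: poly_eval_superset[of ?S] lookup_add distrib_right sum.distrib)
qed

lemma poly_eval_single: "poly_eval (Poly_Mapping.single \<alpha> c) x = c * eval_monomial x \<alpha>"
  by (subst poly_eval_superset[of "{\<alpha>}"]) auto

lemma form_imp_poly:
  assumes "form m V f"
  shows "\<exists>p. homogeneous_poly m p \<and> poly_vars p \<subseteq> V \<and> (\<forall>x. poly_eval p x = f x)"
  using assms
proof (induction rule: form.induct)
  case zero
  show ?case
    by (intro exI[of _ 0]) (simp add: homogeneous_poly_def poly_vars_def poly_eval_def)
next
  case (add_monomial f xs c)
  then obtain p where p: "homogeneous_poly m p" "poly_vars p \<subseteq> V" "\<And>x. poly_eval p x = f x"
    by blast
  let ?q = "Poly_Mapping.single (monomial_of xs) c + p"
  have "\<alpha> = monomial_of xs \<or> \<alpha> \<in> Poly_Mapping.keys p" if "\<alpha> \<in> Poly_Mapping.keys ?q" for \<alpha>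
    using that Poly_Mapping.keys_add[of "Poly_Mapping.single (monomial_of xs) c" p]
    by (auto split: if_splits)
  then have "monom_degree \<alpha> = m \<and> Poly_Mapping.keys \<alpha> \<subseteq> V" if "\<alpha> \<in> Poly_Mapping.keys ?q" for \<alpha>
    using that p(1,2) add_monomial.hyps keys_monomial_of[of xs] monom_degree_monomial_of[of xs]
    unfolding homogeneous_poly_def poly_vars_def by blast
  then have "homogeneous_poly m ?q \<and> poly_vars ?q \<subseteq> V"
    unfolding homogeneous_poly_def poly_vars_def by blast
  then show ?case
    by (intro exI[of _ ?q]) (simp add: poly_eval_add poly_eval_single eval_monomial_of p(3))
qed

lemma homogeneous_polyE:
  assumes "homogeneous_poly m p" "poly_vars p \<subseteq> V" "\<alpha> \<in> Poly_Mapping.keys p"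
  obtains xs where "monomial_of xs = \<alpha>" "length xs = m" "set xs \<subseteq> V"
proof -
  obtain xs where xs: "monomial_of xs = \<alpha>" using ex_monomial_of by blast
  moreover have "length xs = m"
    using assms xs by (auto simp: homogeneous_poly_def monom_degree_monomial_of)
  moreover have "set xs \<subseteq> V"
    using assms(2,3) xs keys_monomial_of[of xs] by (auto simp: poly_vars_def)
  ultimately show ?thesis using that by blast
qed

lemma poly_imp_form:
  assumes "homogeneous_poly m p" "poly_vars p \<subseteq> V"
  shows "form m V (poly_eval p)"
proof -
  have "form m V (\<lambda>x. \<Sum>\<alpha>\<in>Poly_Mapping.keys p. Poly_Mapping.lookup p \<alpha> * eval_monomial x \<alpha>)"
  proof (rule form_sum)
    fix \<alpha> assume "\<alpha> \<in> Poly_Mapping.keys p"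
    then obtain xs where "monomial_of xs = \<alpha>" "length xs = m" "set xs \<subseteq> V"
      by (rule homogeneous_polyE[OF assms])
    then show "form m V (\<lambda>x. Poly_Mapping.lookup p \<alpha> * eval_monomial x \<alpha>)"
      using form_monomial[of xs m V "Poly_Mapping.lookup p \<alpha>"] by (auto simp: eval_monomial_of)
  qed
  moreover have "poly_eval p =
      (\<lambda>x. \<Sum>\<alpha>\<in>Poly_Mapping.keys p. Poly_Mapping.lookup p \<alpha> * eval_monomial x \<alpha>)"
    by (simp add: poly_eval_def eval_monomial_def fun_eq_iff)
  ultimately show ?thesis by simp
qed

lemma polarization_sum:
  "polarization m (\<lambda>x. \<Sum>i\<in>S. f i x) v = (\<Sum>i\<in>S. polarization m (f i) v)"
  unfolding polarization_def by (subst sum.swap) (simp add: sum_distrib_left)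

text \<open>A monomial \<open>\<beta>\<close> of \<open>p\<close> is given by a word
  \<open>xs\<close>. Polarizing at the unit vectors of its letters kills all other monomials and
  leaves the coefficient of \<open>\<beta>\<close> times a positive count. So \<open>p\<close>
  cannot vanish at all points supported on \<open>V\<close>.\<close>

lemma poly_eval_nonzero:
  assumes hom: "homogeneous_poly m p" and vars: "poly_vars p \<subseteq> V" and "p \<noteq> 0"
  obtains x where "\<And>i. i \<notin> V \<Longrightarrow> x i = 0" "poly_eval p x \<noteq> 0"
proof (rule ccontr)
  assume "\<not> thesis"
  note witness = that
  have vanish: "poly_eval p x = 0" if "\<And>i. i \<notin> V \<Longrightarrow> x i = 0" for x
    using witness[of x] that \<open>\<not> thesis\<close> by blast
  obtain \<beta> where \<beta>: "\<beta> \<in> Poly_Mapping.keys p"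
    using \<open>p \<noteq> 0\<close> by (metis all_not_in_conv keys_eq_empty)
  then obtain xs where xs: "monomial_of xs = \<beta>" "length xs = m" "set xs \<subseteq> V"
    by (rule homogeneous_polyE[OF hom vars])
  define v :: "nat \<Rightarrow> 'a \<Rightarrow> complex" where "v i y = of_bool (y = xs ! i)" for i y
  have "v i y = 0" if "i < m" "y \<notin> V" for i y
    using that xs(2) subsetD[OF xs(3) nth_mem, of i] by (auto simp: v_def)
  then have "polarization m (poly_eval p) v = 0"
    unfolding polarization_def by (intro sum.neutral ballI) (simp add: vanish)
  moreover have "polarization m (poly_eval p) v =
      (\<Sum>\<alpha>\<in>Poly_Mapping.keys p. polarization m (\<lambda>x. Poly_Mapping.lookup p \<alpha> * eval_monomial x \<alpha>) v)"
    unfolding polarization_sum[symmetric] by (simp add: poly_eval_def[abs_def] eval_monomial_def)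
  moreover have "\<dots> = (\<Sum>\<alpha>\<in>{\<beta>}. polarization m (\<lambda>x. Poly_Mapping.lookup p \<alpha> * eval_monomial x \<alpha>) v)"
  proof (rule sum.mono_neutral_right)
    show "\<forall>\<alpha>\<in>Poly_Mapping.keys p - {\<beta>}.
        polarization m (\<lambda>x. Poly_Mapping.lookup p \<alpha> * eval_monomial x \<alpha>) v = 0"
    proof
      fix \<alpha> assume \<alpha>: "\<alpha> \<in> Poly_Mapping.keys p - {\<beta>}"
      then obtain ys where ys: "monomial_of ys = \<alpha>" "length ys = m"
        using homogeneous_polyE[OF hom vars] by blast
      \<comment> \<open>A nonzero product would make \<open>ys\<close> a rearrangement of
        \<open>xs\<close>, hence the same monomial.\<close>
      have "(\<Prod>j<m. v (\<phi> j) (ys ! j)) = 0" if \<phi>: "\<phi> permutes {..<m}" for \<phi>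
      proof (rule ccontr)
        assume "(\<Prod>j<m. v (\<phi> j) (ys ! j)) \<noteq> 0"
        then have "\<forall>j<m. ys ! j = xs ! \<phi> j"
          by (auto simp: v_def)
        then have "ys = permute_list \<phi> xs"
          using xs(2) ys(2) by (intro nth_equalityI) (auto simp: permute_list_def)
        then have "mset ys = mset xs" using \<phi> xs(2) by simp
        then show False using \<alpha> xs(1) ys(1) monomial_of_eq_iff by blast
      qed
      then have "(\<Sum>\<phi> | \<phi> permutes {..<m}. \<Prod>j<m. v (\<phi> j) (ys ! j)) = 0"
        by (intro sum.neutral) blast
      then show "polarization m (\<lambda>x. Poly_Mapping.lookup p \<alpha> * eval_monomial x \<alpha>) v = 0"
        unfolding ys(1)[symmetric] eval_monomial_of polarization_monomial[OF ys(2)] by simp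
    qed
  qed (use \<beta> in auto)
  moreover have "polarization m (\<lambda>x. Poly_Mapping.lookup p \<beta> * eval_monomial x \<beta>) v =
      Poly_Mapping.lookup p \<beta> * 2 ^ m * of_nat (card {\<phi>. \<phi> permutes {..<m} \<and> (\<forall>j<m. xs ! j = xs ! \<phi> j)})"
  proof -
    have "(\<Prod>j<m. v (\<phi> j) (xs ! j)) = of_bool (\<forall>j<m. xs ! j = xs ! \<phi> j)" for \<phi>
      by (auto simp: v_def of_bool_def intro: prod_zero)
    then have "(\<Sum>\<phi> | \<phi> permutes {..<m}. \<Prod>j<m. v (\<phi> j) (xs ! j)) =
        of_nat (card {\<phi>. \<phi> permutes {..<m} \<and> (\<forall>j<m. xs ! j = xs ! \<phi> j)})"
      by (simp add: finite_permutations sum_of_bool_eq Collect_conj_eq)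
    then show ?thesis
      unfolding xs(1)[symmetric] eval_monomial_of polarization_monomial[OF xs(2)] by simp
  qed
  moreover have "card {\<phi>. \<phi> permutes {..<m} \<and> (\<forall>j<m. xs ! j = xs ! \<phi> j)} \<noteq> 0"
  proof -
    have "id \<in> {\<phi>. \<phi> permutes {..<m} \<and> (\<forall>j<m. xs ! j = xs ! \<phi> j)}" by (simp add: permutes_id)
    moreover have "finite {\<phi>. \<phi> permutes {..<m} \<and> (\<forall>j<m. xs ! j = xs ! \<phi> j)}"
      using finite_permutations[of "{..<m}"] by simp
    ultimately show ?thesis by (simp only: card_eq_0_iff) blast
  qed
  ultimately show False using \<beta> by (simp add: in_keys_iff)
qed

section \<open>Invariants of tensor products\<close>

text \<open>Works with polynomial functions instead of formal polynomials; a nonzero value on the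
  tensor space stands for \<open>p \<noteq> 0\<close>.\<close>

definition invariant_form :: "nat list \<Rightarrow> nat \<Rightarrow> (tensor \<Rightarrow> complex) \<Rightarrow> bool" where
  "invariant_form ns m f \<longleftrightarrow> form m (multi_indices ns) f \<and>
     (\<forall>gs\<in>SL_prod ns. \<forall>T\<in>tensor_space ns. f (tensor_act ns gs T) = f T) \<and>
     (\<exists>T\<in>tensor_space ns. f T \<noteq> 0)"

lemma ex_invariant_form_iff:
  "(\<exists>p. p \<noteq> 0 \<and> homogeneous_poly m p \<and> invariant_poly ns p) \<longleftrightarrow> (\<exists>f. invariant_form ns m f)"
proof
  assume "\<exists>p. p \<noteq> 0 \<and> homogeneous_poly m p \<and> invariant_poly ns p"
  then obtain p where p: "p \<noteq> 0" "homogeneous_poly m p" "invariant_poly ns p" by blast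
  then have vars: "poly_vars p \<subseteq> multi_indices ns" by (simp add: invariant_poly_def)
  obtain T where "\<And>i. i \<notin> multi_indices ns \<Longrightarrow> T i = 0" "poly_eval p T \<noteq> 0"
    using poly_eval_nonzero[OF p(2) vars p(1)] by blast
  then have "invariant_form ns m (poly_eval p)"
    using p poly_imp_form[OF p(2) vars]
    by (auto simp: invariant_form_def invariant_poly_def tensor_space_def)
  then show "\<exists>f. invariant_form ns m f" by blast
next
  assume "\<exists>f. invariant_form ns m f"
  then obtain f where f: "invariant_form ns m f" by blast
  then obtain p where p: "homogeneous_poly m p" "poly_vars p \<subseteq> multi_indices ns"
      "\<And>x. poly_eval p x = f x"
    unfolding invariant_form_def using form_imp_poly by blast
  moreover have "p \<noteq> 0"
    using f p(3) by (auto simp: invariant_form_def poly_eval_def)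
  ultimately show "\<exists>p. p \<noteq> 0 \<and> homogeneous_poly m p \<and> invariant_poly ns p"
    using f by (auto simp: invariant_form_def invariant_poly_def)
qed

lemma delta_eq: "delta ns = Inf {enat m |m. 0 < m \<and> (\<exists>f. invariant_form ns m f)}"
  unfolding delta_def ex_invariant_form_iff ..

lemma delta_le: "invariant_form ns m f \<Longrightarrow> 0 < m \<Longrightarrow> delta ns \<le> enat m"
  unfolding delta_eq by (rule Inf_lower) blast

lemma delta_attained:
  assumes "delta ns \<noteq> \<infinity>"
  obtains m f where "0 < m" "invariant_form ns m f" "delta ns = enat m"
proof -
  let ?A = "{enat m |m. 0 < m \<and> (\<exists>f. invariant_form ns m f)}"
  have "?A \<noteq> {}" using assms unfolding delta_eq by (metis Inf_enat_def)
  then have "Inf ?A \<in> ?A" by (metis (mono_tags, lifting) Inf_enat_def LeastI ex_in_conv)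
  then show ?thesis using that unfolding delta_eq[symmetric] by blast
qed

lemma invariant_form_power:
  assumes "invariant_form ns m f"
  shows "invariant_form ns (m * k) (\<lambda>T. f T ^ k)"
  using assms form_power by (auto simp: invariant_form_def) 

text \<open>An entry of the Kronecker product of the matrices \<open>gs\<close>.\<close>

definition act_coeff :: "nat list \<Rightarrow> complex mat list \<Rightarrow> nat list \<Rightarrow> nat list \<Rightarrow> complex" where
  "act_coeff ns gs is js = (\<Prod>k<length ns. (gs ! k) $$ (is ! k, js ! k))"

lemma tensor_act_eq:
  "is \<in> multi_indices ns \<Longrightarrow>
    tensor_act ns gs T is = (\<Sum>js\<in>multi_indices ns. act_coeff ns gs is js * T js)"
  by (simp add: tensor_act_def act_coeff_def)

lemma length_multi_indices: "is \<in> multi_indices ns \<Longrightarrow> length is = length ns"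
  by (auto simp: multi_indices_def dest: list_all2_lengthD)

lemma multi_indices_append:
  "multi_indices (ns @ ns') = (\<lambda>(xs, ys). xs @ ys) ` (multi_indices ns \<times> multi_indices ns')"
  by (auto simp: multi_indices_def list_all2_append2 intro: list_all2_appendI)
    (force dest: list_all2_lengthD)+

lemma sum_multi_indices_append:
  "(\<Sum>z\<in>multi_indices (ns @ ns'). f z) =
    (\<Sum>xs\<in>multi_indices ns. \<Sum>ys\<in>multi_indices ns'. f (xs @ ys))"
proof -
  have "inj_on (\<lambda>(xs, ys). xs @ ys) (multi_indices ns \<times> multi_indices ns')"
    by (auto simp: inj_on_def dest!: length_multi_indices)
  then show ?thesis
    unfolding multi_indices_append
    by (subst sum.reindex) (auto simp: sum.cartesian_product intro!: sum.cong)
qed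

lemma prod_lessThan_add:
  "(\<Prod>k<a + b. f k) = (\<Prod>k<a. f k) * (\<Prod>k<b. f (a + k) :: 'a::comm_monoid_mult)" for a b :: nat
  by (induction b) (auto simp: mult.assoc)

lemma act_coeff_append:
  assumes "length gs = length ns" "length xs = length ns" "length xs' = length ns"
  shows "act_coeff (ns @ ns') (gs @ hs) (xs @ ys) (xs' @ ys') =
    act_coeff ns gs xs xs' * act_coeff ns' hs ys ys'"
  using assms by (simp add: act_coeff_def prod_lessThan_add nth_append)

text \<open>Invariance of \<open>f\<close> read off on coefficients: the polarization has the same
  value at the unit vectors at \<open>Z i\<close> and at their images under \<open>gs\<close>, which
  are columns of the Kronecker product. The first value is \<open>A Z\<close>, the second is the
  sum.\<close>

lemma polarization_invariant:
  assumes f: "invariant_form ns m f"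
    and A: "\<And>v. polarization m f v = (\<Sum>X\<in>{..<m} \<rightarrow>\<^sub>E multi_indices ns. A X * (\<Prod>i<m. v i (X i)))"
    and gs: "gs \<in> SL_prod ns" and Z: "Z \<in> {..<m} \<rightarrow>\<^sub>E multi_indices ns"
  shows "(\<Sum>X\<in>{..<m} \<rightarrow>\<^sub>E multi_indices ns. A X * (\<Prod>i<m. act_coeff ns gs (X i) (Z i))) = A Z"
proof -
  let ?V = "multi_indices ns"
  have fin: "finite ({..<m} \<rightarrow>\<^sub>E ?V)" by (simp add: finite_PiE finite_multi_indices)
  have ZV: "Z i \<in> ?V" if "i < m" for i using Z that by auto
  let ?e = "\<lambda>i js. of_bool (js = Z i) :: complex"
  \<comment> \<open>Column \<open>Z i\<close> of the Kronecker product, extended by 0 outside the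
    index set.\<close>
  let ?g = "\<lambda>i js. if js \<in> ?V then act_coeff ns gs js (Z i) else 0"
  have act: "tensor_act ns gs (\<lambda>x. \<Sum>i<m. s i * ?e i x) = (\<lambda>x. \<Sum>i<m. s i * ?g i x)" for s
  proof
    fix x
    show "tensor_act ns gs (\<lambda>x. \<Sum>i<m. s i * ?e i x) x = (\<Sum>i<m. s i * ?g i x)"
    proof (cases "x \<in> ?V")
      case True
      have "(\<Sum>js\<in>?V. act_coeff ns gs x js * (\<Sum>i<m. s i * ?e i js)) =
          (\<Sum>i<m. \<Sum>js\<in>?V. if js = Z i then s i * act_coeff ns gs x (Z i) else 0)"
        unfolding sum_distrib_left by (subst sum.swap) (auto intro!: sum.cong)
      also have "\<dots> = (\<Sum>i<m. s i * act_coeff ns gs x (Z i))"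
        using ZV by (intro sum.cong refl) (simp add: finite_multi_indices)
      finally show ?thesis using True by (simp add: tensor_act_eq)
    next
      case False
      then show ?thesis by (simp add: tensor_act_def)
    qed
  qed
  have "(\<lambda>x. \<Sum>i<m. s i * ?e i x) \<in> tensor_space ns" for s
    using ZV by (auto simp: tensor_space_def intro!: sum.neutral)
  then have "polarization m f ?g = polarization m f ?e"
    using f gs unfolding polarization_def act[symmetric] by (simp add: invariant_form_def)
  moreover have "polarization m f ?g =
      (\<Sum>X\<in>{..<m} \<rightarrow>\<^sub>E ?V. A X * (\<Prod>i<m. act_coeff ns gs (X i) (Z i)))"
    unfolding A by (intro sum.cong refl arg_cong2[where f="(*)"] prod.cong) auto
  moreover have "polarization m f ?e = A Z"
  proof -
    have "(\<Prod>i<m. ?e i (X i)) = of_bool (X = Z)" if X: "X \<in> {..<m} \<rightarrow>\<^sub>E ?V" for X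
    proof (cases "X = Z")
      case False
      then obtain i where "i < m" "X i \<noteq> Z i"
        using PiE_ext[OF X Z] by auto
      then show ?thesis using False by (auto intro: prod_zero)
    qed simp
    then have "polarization m f ?e = (\<Sum>X\<in>{..<m} \<rightarrow>\<^sub>E ?V. A X * of_bool (X = Z))"
      unfolding A by simp
    also have "\<dots> = (\<Sum>X\<in>{..<m} \<rightarrow>\<^sub>E ?V. if X = Z then A X else 0)"
      by (intro sum.cong) auto
    also have "\<dots> = A Z" using fin Z by simp
    finally show ?thesis .
  qed
  ultimately show ?thesis by simp
qed

section \<open>Invariants on a tensor product of two spaces and the upper bound\<close>

lemma sum_rotate:
  "(\<Sum>a\<in>A. \<Sum>b\<in>B. \<Sum>c\<in>C. h a b c) = (\<Sum>b\<in>B. \<Sum>c\<in>C. \<Sum>a\<in>A. h a b c)"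
  by (subst sum.swap) (intro sum.cong refl sum.swap)

lemma sum_swap_pairs:
  "(\<Sum>a\<in>A. \<Sum>b\<in>B. \<Sum>c\<in>C. \<Sum>d\<in>D. h a b c d) = (\<Sum>c\<in>C. \<Sum>d\<in>D. \<Sum>a\<in>A. \<Sum>b\<in>B. h a b c d)"
  by (rule trans[OF _ sum_rotate]) (intro sum.cong refl sum_rotate)

lemma invariant_form_tensor:
  assumes P: "invariant_form ns m P" and Q: "invariant_form ns' m Q"
  shows "\<exists>f. invariant_form (ns @ ns') m f"
proof -
  let ?V = "multi_indices ns" and ?W = "multi_indices ns'"
  let ?F = "{..<m} \<rightarrow>\<^sub>E ?V" and ?G = "{..<m} \<rightarrow>\<^sub>E ?W"
  have fin: "finite ?F" "finite ?G" by (auto simp: finite_PiE finite_multi_indices)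
  have formP: "form m ?V P" and formQ: "form m ?W Q"
    using P Q by (simp_all add: invariant_form_def)
  obtain A where A: "\<And>v. polarization m P v = (\<Sum>X\<in>?F. A X * (\<Prod>i<m. v i (X i)))"
    using polarization_multilinear[OF formP finite_multi_indices] by blast
  obtain B where B: "\<And>v. polarization m Q v = (\<Sum>Y\<in>?G. B Y * (\<Prod>i<m. v i (Y i)))"
    using polarization_multilinear[OF formQ finite_multi_indices] by blast
  \<comment> \<open>The product of the two multilinear forms evaluated at \<open>m\<close> copies of
    \<open>T\<close>; copy \<open>i\<close> fills argument \<open>i\<close> of both.\<close>
  define f where "f T = (\<Sum>X\<in>?F. \<Sum>Y\<in>?G. A X * B Y * (\<Prod>i<m. T (X i @ Y i)))" for T :: tensor
  have app: "x @ y \<in> multi_indices (ns @ ns')" if "x \<in> ?V" "y \<in> ?W" for x y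
    using that by (force simp: multi_indices_append)
  have "form m (multi_indices (ns @ ns')) f"
    unfolding f_def
  proof (rule form_sum, rule form_sum)
    fix X Y assume XY: "X \<in> ?F" "Y \<in> ?G"
    have "form m (multi_indices (ns @ ns'))
        (\<lambda>T. A X * B Y * prod_list (map T (map (\<lambda>i. X i @ Y i) [0..<m])))"
    proof (rule form_monomial)
      show "set (map (\<lambda>i. X i @ Y i) [0..<m]) \<subseteq> multi_indices (ns @ ns')"
        using XY app by (auto simp: PiE_iff)
    qed simp
    then show "form m (multi_indices (ns @ ns')) (\<lambda>T. A X * B Y * (\<Prod>i<m. T (X i @ Y i)))"
      by (simp add: comp_def prod.distinct_set_conv_list[symmetric] atLeast0LessThan)
  qed
  moreover have "f (tensor_act (ns @ ns') us T) = f T" if us: "us \<in> SL_prod (ns @ ns')" for us T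
  proof -
    obtain gs hs where u: "us = gs @ hs" "gs \<in> SL_prod ns" "hs \<in> SL_prod ns'"
      using us by (auto simp: SL_prod_def list_all2_append2)
    have len: "length gs = length ns" using u(2) by (auto simp: SL_prod_def dest: list_all2_lengthD)
    let ?g = "act_coeff ns gs" and ?h = "act_coeff ns' hs"
    have "tensor_act (ns @ ns') us T (x @ y) = (\<Sum>x'\<in>?V. \<Sum>y'\<in>?W. ?g x x' * ?h y y' * T (x' @ y'))"
      if "x \<in> ?V" "y \<in> ?W" for x y
      using that len unfolding u(1) tensor_act_eq[OF app[OF that]] sum_multi_indices_append
      by (intro sum.cong refl) (simp add: act_coeff_append length_multi_indices)
    then have "f (tensor_act (ns @ ns') us T) = (\<Sum>X\<in>?F. \<Sum>Y\<in>?G. A X * B Y *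
        (\<Prod>i<m. \<Sum>x'\<in>?V. \<Sum>y'\<in>?W. ?g (X i) x' * ?h (Y i) y' * T (x' @ y')))"
      unfolding f_def by (intro sum.cong refl arg_cong2[where f="(*)"] prod.cong) auto
    also have "\<dots> = (\<Sum>X\<in>?F. \<Sum>Y\<in>?G. A X * B Y * (\<Sum>X'\<in>?F. \<Sum>Y'\<in>?G.
        (\<Prod>i<m. ?g (X i) (X' i)) * (\<Prod>i<m. ?h (Y i) (Y' i)) * (\<Prod>i<m. T (X' i @ Y' i))))"
      by (simp add: prod_sum_PiE finite_multi_indices prod.distrib)
    also have "\<dots> = (\<Sum>X\<in>?F. \<Sum>Y\<in>?G. \<Sum>X'\<in>?F. \<Sum>Y'\<in>?G. (A X * (\<Prod>i<m. ?g (X i) (X' i))) *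
        (B Y * (\<Prod>i<m. ?h (Y i) (Y' i))) * (\<Prod>i<m. T (X' i @ Y' i)))"
      by (simp add: sum_distrib_left mult.assoc mult.left_commute)
    also have "\<dots> = (\<Sum>X'\<in>?F. \<Sum>Y'\<in>?G. \<Sum>X\<in>?F. \<Sum>Y\<in>?G. (A X * (\<Prod>i<m. ?g (X i) (X' i))) *
        (B Y * (\<Prod>i<m. ?h (Y i) (Y' i))) * (\<Prod>i<m. T (X' i @ Y' i)))"
      by (rule sum_swap_pairs)
    \<comment> \<open>For fixed \<open>X'\<close> and \<open>Y'\<close> the sums over
      \<open>X\<close> and \<open>Y\<close> separate, and \<open>polarization_invariant\<close>
      reduces them to \<open>A X'\<close> and \<open>B Y'\<close>.\<close>
    also have "\<dots> = (\<Sum>X'\<in>?F. \<Sum>Y'\<in>?G. (\<Sum>X\<in>?F. A X * (\<Prod>i<m. ?g (X i) (X' i))) *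
        (\<Sum>Y\<in>?G. B Y * (\<Prod>i<m. ?h (Y i) (Y' i))) * (\<Prod>i<m. T (X' i @ Y' i)))"
      unfolding sum_product unfolding sum_distrib_right ..
    also have "\<dots> = f T"
      unfolding f_def
      by (intro sum.cong refl)
        (simp add: polarization_invariant[OF P A u(2)] polarization_invariant[OF Q B u(3)])
    finally show ?thesis .
  qed
  moreover have "\<exists>T\<in>tensor_space (ns @ ns'). f T \<noteq> 0"
  proof -
    obtain v w where vw: "P v \<noteq> 0" "Q w \<noteq> 0" using P Q by (auto simp: invariant_form_def)
    \<comment> \<open>The tensor \<open>v \<otimes> w\<close> in coordinates; there \<open>f\<close>
      is the product of both polarizations on the diagonal.\<close>
    define T where "T z = (if z \<in> multi_indices (ns @ ns')
      then v (take (length ns) z) * w (drop (length ns) z) else 0)" for z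
    have "T (x @ y) = v x * w y" if "x \<in> ?V" "y \<in> ?W" for x y
      using that app[OF that] by (simp add: T_def length_multi_indices)
    then have "f T = (\<Sum>X\<in>?F. \<Sum>Y\<in>?G. A X * B Y * (\<Prod>i<m. v (X i) * w (Y i)))"
      unfolding f_def by (intro sum.cong refl arg_cong2[where f="(*)"] prod.cong) auto
    also have "\<dots> = polarization m P (\<lambda>_. v) * polarization m Q (\<lambda>_. w)"
      unfolding A B sum_product by (simp add: prod.distrib mult.assoc mult.left_commute)
    also have "\<dots> \<noteq> 0"
      using vw by (simp add: polarization_diag[OF formP] polarization_diag[OF formQ])
    finally have "f T \<noteq> 0" .
    moreover have "T \<in> tensor_space (ns @ ns')" by (simp add: T_def tensor_space_def)
    ultimately show ?thesis by blast
  qed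
  ultimately show ?thesis unfolding invariant_form_def by blast
qed

lemma delta_append_le:
  assumes "delta ns \<noteq> \<infinity>" "delta ns' \<noteq> \<infinity>"
  shows "delta (ns @ ns') \<le> enat (lcm (the_enat (delta ns)) (the_enat (delta ns')))"
proof -
  obtain a P where P: "0 < a" "invariant_form ns a P" "delta ns = enat a"
    using assms(1) by (rule delta_attained)
  obtain b Q where Q: "0 < b" "invariant_form ns' b Q" "delta ns' = enat b"
    using assms(2) by (rule delta_attained)
  let ?m = "lcm a b"
  have "invariant_form ns ?m (\<lambda>T. P T ^ (?m div a))"
    using invariant_form_power[OF P(2), of "?m div a"] by simp
  moreover have "invariant_form ns' ?m (\<lambda>T. Q T ^ (?m div b))"
    using invariant_form_power[OF Q(2), of "?m div b"] by simp
  ultimately obtain f where "invariant_form (ns @ ns') ?m f"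
    using invariant_form_tensor by blast
  then show ?thesis
    using delta_le[of "ns @ ns'" ?m f] P(1,3) Q(1,3) by (simp add: lcm_pos_nat)
qed

section \<open>Cayley's operator\<close>

text \<open>Index set of the expansion of \<open>det A ^ r\<close> by the Leibniz formula, with one
  permutation per factor.\<close>

definition perm_families :: "nat \<Rightarrow> nat \<Rightarrow> (nat \<Rightarrow> nat \<Rightarrow> nat) set" where
  "perm_families n r = {..<r} \<rightarrow>\<^sub>E {p. p permutes {..<n}}"

definition family_sign :: "nat \<Rightarrow> (nat \<Rightarrow> nat \<Rightarrow> nat) \<Rightarrow> int" where
  "family_sign r \<sigma> = (\<Prod>q<r. sign (\<sigma> q))"

text \<open>The number \<open>j = q n + a\<close> with \<open>a < n\<close> and \<open>q < r\<close> encodes the entry in row \<open>a\<close> and column \<open>\<sigma>\<^sub>q(a)\<close>,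
  taken from the \<open>q\<close>-th of \<open>r\<close> copies of an \<open>n \<times> n\<close> matrix.\<close>

definition cell :: "nat \<Rightarrow> (nat \<Rightarrow> nat \<Rightarrow> nat) \<Rightarrow> nat \<Rightarrow> nat \<times> nat" where
  "cell n \<sigma> j = (j mod n, \<sigma> (j div n) (j mod n))"

lemma finite_perm_families [simp]: "finite (perm_families n r)"
  by (simp add: perm_families_def finite_PiE finite_permutations)

lemma det_power_eq:
  assumes A: "(A :: complex mat) \<in> carrier_mat n n"
  shows "det A ^ r = (\<Sum>\<rho>\<in>perm_families n r.
    of_int (family_sign r \<rho>) * (\<Prod>j<r * n. A $$ cell n \<rho> j))"
proof -
  have *: "(\<Prod>q<r. \<Prod>i<n. A $$ (i, \<rho> q i)) = (\<Prod>j<r * n. A $$ cell n \<rho> j)" for \<rho>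
  proof -
    \<comment> \<open>Positions \<open>q * n\<close> to \<open>q * n + n - 1\<close> are the rows of
      factor \<open>q\<close>.\<close>
    have "(\<Prod>j\<in>{q * n..<q * n + n}. A $$ cell n \<rho> j) = (\<Prod>i<n. A $$ (i, \<rho> q i))" for q
      by (subst prod.atLeastLessThan_shift_0) (auto simp: cell_def atLeast0LessThan intro!: prod.cong)
    then show ?thesis using prod.nat_group[of "\<lambda>j. A $$ cell n \<rho> j" n r] by simp
  qed
  have "det A = (\<Sum>p\<in>{p. p permutes {..<n}}. of_int (sign p) * (\<Prod>i<n. A $$ (i, p i)))"
    using det_def'[OF A] by (simp add: atLeast0LessThan)
  then have "det A ^ r = (\<Prod>q<r. \<Sum>p\<in>{p. p permutes {..<n}}. of_int (sign p) * (\<Prod>i<n. A $$ (i, p i)))"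
    by simp
  also have "\<dots> = (\<Sum>\<rho>\<in>perm_families n r.
      \<Prod>q<r. of_int (sign (\<rho> q)) * (\<Prod>i<n. A $$ (i, \<rho> q i)))"
    unfolding perm_families_def by (rule prod_sum_PiE) (auto simp: finite_permutations)
  also have "\<dots> = (\<Sum>\<rho>\<in>perm_families n r.
      of_int (family_sign r \<rho>) * (\<Prod>j<r * n. A $$ cell n \<rho> j))"
    by (simp add: prod.distrib * family_sign_def)
  finally show ?thesis .
qed

lemma cell_bounds:
  assumes "\<rho> \<in> perm_families n r" "n > 0" "j < r * n"
  shows "fst (cell n \<rho> j) < n \<and> snd (cell n \<rho> j) < n"
proof -
  have "j div n < r" using assms(3) by (simp add: less_mult_imp_div_less)
  then have "\<rho> (j div n) permutes {..<n}" using assms(1) by (auto simp: perm_families_def)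
  from permutes_in_image[OF this, of "j mod n"] show ?thesis
    using assms(2) by (simp add: cell_def)
qed

definition matching_sign :: "nat \<Rightarrow> nat \<Rightarrow> (nat \<Rightarrow> nat) \<Rightarrow> (nat \<Rightarrow> nat \<times> nat) \<Rightarrow> int" where
  "matching_sign n r \<phi> w =
    (\<Sum>\<sigma>\<in>perm_families n r. family_sign r \<sigma> * (\<Prod>j<r * n. of_bool (cell n \<sigma> (\<phi> j) = w j)))"

text \<open>The result of applying \<open>\<Omega>\<^sup>r\<close>, where \<open>\<Omega>\<close> is Cayley's operator, to the monomial
  \<open>\<Prod>j<rn. A $$ w j\<close>; \<open>matching_sign\<close> is the part of it where the derivatives are matched with
  the factors by \<open>\<phi>\<close>.\<close>

definition omega_coeff :: "nat \<Rightarrow> nat \<Rightarrow> (nat \<Rightarrow> nat \<times> nat) \<Rightarrow> int" where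
  "omega_coeff n r w = (\<Sum>\<phi> | \<phi> permutes {..<r * n}. matching_sign n r \<phi> w)"

lemma omega_coeff_alt: "omega_coeff n r w = (\<Sum>\<sigma>\<in>perm_families n r. family_sign r \<sigma> *
    (\<Sum>\<phi> | \<phi> permutes {..<r * n}. \<Prod>j<r * n. of_bool (cell n \<sigma> (\<phi> j) = w j)))"
  unfolding omega_coeff_def matching_sign_def by (subst sum.swap) (simp add: sum_distrib_left)

lemma omega_coeff_cong:
  assumes "\<And>j. j < r * n \<Longrightarrow> w j = w' j"
  shows "omega_coeff n r w = omega_coeff n r w'"
  unfolding omega_coeff_def matching_sign_def
  by (intro sum.cong refl arg_cong2[where f="(*)"] prod.cong) (simp add: assms)

text \<open>A monomial does not depend on the order of its factors: reordering them only permutes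
  the matchings \<open>\<phi>\<close> in the sum.\<close>

lemma omega_coeff_permute:
  assumes \<pi>: "\<pi> permutes {..<r * n}"
  shows "omega_coeff n r (\<lambda>j. w (\<pi> j)) = omega_coeff n r w"
proof -
  have "(\<Sum>\<phi> | \<phi> permutes {..<r * n}. matching_sign n r \<phi> (\<lambda>j. w (\<pi> j))) =
      (\<Sum>\<phi> | \<phi> permutes {..<r * n}. matching_sign n r (\<phi> \<circ> \<pi>) (\<lambda>j. w (\<pi> j)))"
    by (rule sum_permutations_compose_right[OF \<pi>])
  moreover have "matching_sign n r (\<phi> \<circ> \<pi>) (\<lambda>j. w (\<pi> j)) = matching_sign n r \<phi> w" for \<phi>
    unfolding matching_sign_def
    by (intro sum.cong refl arg_cong2[where f="(*)"], subst (2) prod.permute[OF \<pi>]) simp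
  ultimately show ?thesis by (simp add: omega_coeff_def)
qed

text \<open>The left-hand side is, up to a factor, \<open>\<Omega>\<^sup>r(det\<^sup>r)\<close>. Writing it as a sum of squares shows that it
  does not vanish.\<close>

lemma sum_family_sign_omega_coeff:
  assumes "n > 0"
  shows "fact (r * n) * (\<Sum>\<rho>\<in>perm_families n r. family_sign r \<rho> * omega_coeff n r (cell n \<rho>)) =
    (\<Sum>w\<in>{..<r * n} \<rightarrow>\<^sub>E ({..<n} \<times> {..<n}). (omega_coeff n r w)\<^sup>2)"
proof -
  let ?m = "r * n" and ?W = "{..<r * n} \<rightarrow>\<^sub>E ({..<n} \<times> {..<n})"
  have fin: "finite ?W" by (simp add: finite_PiE)
  \<comment> \<open>The indicator selects the word \<open>cell n \<rho> \<circ> \<pi>\<close>, and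
    by \<open>omega_coeff_permute\<close> its coefficient does not depend on
    \<open>\<pi>\<close>.\<close>
  have eval: "(\<Sum>w\<in>?W. omega_coeff n r w * (\<Prod>j<?m. of_bool (cell n \<rho> (\<pi> j) = w j))) =
      omega_coeff n r (cell n \<rho>)" if \<rho>: "\<rho> \<in> perm_families n r" and \<pi>: "\<pi> permutes {..<?m}" for \<rho> \<pi>
  proof -
    define w\<^sub>0 where "w\<^sub>0 = restrict (\<lambda>j. cell n \<rho> (\<pi> j)) {..<?m}"
    have w\<^sub>0: "w\<^sub>0 j = cell n \<rho> (\<pi> j)" if "j < ?m" for j using that by (simp add: w\<^sub>0_def)
    have cell_in: "cell n \<rho> i \<in> {..<n} \<times> {..<n}" if "i < ?m" for i
      using cell_bounds[OF \<rho> assms that] by (simp add: mem_Times_iff)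
    have w: "w\<^sub>0 \<in> ?W"
      unfolding w\<^sub>0_def using cell_in permutes_in_image[OF \<pi>] by (intro restrict_PiE_iff[THEN iffD2] ballI) auto
    have "(\<Prod>j<?m. of_bool (cell n \<rho> (\<pi> j) = w j)) = (of_bool (w = w\<^sub>0) :: int)" if "w \<in> ?W" for w
    proof (cases "w = w\<^sub>0")
      case False
      then have "\<exists>j\<in>{..<?m}. cell n \<rho> (\<pi> j) \<noteq> w j"
        using PiE_ext[OF that w] w\<^sub>0 by (metis lessThan_iff)
      then have "\<exists>j\<in>{..<?m}. of_bool (cell n \<rho> (\<pi> j) = w j) = (0::int)" by auto
      then have "(\<Prod>j<?m. of_bool (cell n \<rho> (\<pi> j) = w j)) = (0 :: int)"
        by (intro prod_zero) auto
      then show ?thesis using False by simp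
    next
      case True
      then show ?thesis by (simp add: w\<^sub>0)
    qed
    then have "(\<Sum>w\<in>?W. omega_coeff n r w * (\<Prod>j<?m. of_bool (cell n \<rho> (\<pi> j) = w j))) =
        (\<Sum>w\<in>?W. if w = w\<^sub>0 then omega_coeff n r w else 0)"
      by (intro sum.cong refl) simp
    also have "\<dots> = omega_coeff n r w\<^sub>0" using fin w by simp
    also have "\<dots> = omega_coeff n r (\<lambda>j. cell n \<rho> (\<pi> j))" by (rule omega_coeff_cong) (rule w\<^sub>0)
    also have "\<dots> = omega_coeff n r (cell n \<rho>)" by (rule omega_coeff_permute[OF \<pi>])
    finally show ?thesis .
  qed
  \<comment> \<open>Only one factor of each square is expanded; all \<open>fact (r * n)\<close>
    permutations \<open>\<pi>\<close> then contribute equally.\<close>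
  have "(\<Sum>w\<in>?W. (omega_coeff n r w)\<^sup>2) =
      (\<Sum>w\<in>?W. \<Sum>\<rho>\<in>perm_families n r. \<Sum>\<pi> | \<pi> permutes {..<?m}.
        family_sign r \<rho> * (omega_coeff n r w * (\<Prod>j<?m. of_bool (cell n \<rho> (\<pi> j) = w j))))"
    unfolding power2_eq_square
    by (subst (2) omega_coeff_alt) (simp only: sum_distrib_left mult.left_commute)
  also have "\<dots> = (\<Sum>\<rho>\<in>perm_families n r. \<Sum>\<pi> | \<pi> permutes {..<?m}. \<Sum>w\<in>?W.
        family_sign r \<rho> * (omega_coeff n r w * (\<Prod>j<?m. of_bool (cell n \<rho> (\<pi> j) = w j))))"
    by (rule sum_rotate)
  also have "\<dots> = (\<Sum>\<rho>\<in>perm_families n r. \<Sum>\<pi> | \<pi> permutes {..<?m}.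
        family_sign r \<rho> * omega_coeff n r (cell n \<rho>))"
    by (intro sum.cong refl) (simp only: sum_distrib_left[symmetric], subst eval, auto)
  also have "\<dots> = fact ?m * (\<Sum>\<rho>\<in>perm_families n r. family_sign r \<rho> * omega_coeff n r (cell n \<rho>))"
    by (simp add: card_permutations sum_distrib_left)
  finally show ?thesis by simp
qed

text \<open>The monomial contains each diagonal entry \<open>r\<close> times. A matching forces all
  cells of \<open>\<sigma>\<close> onto the diagonal, so that every \<open>\<sigma> q\<close> is the
  identity; hence no signs cancel and the identity matching contributes 1.\<close>

lemma omega_coeff_diag:
  assumes "n > 0"
  shows "omega_coeff n r (\<lambda>j. (j mod n, j mod n)) > 0"
proof -
  let ?m = "r * n"
  let ?id = "restrict (\<lambda>_. id) {..<r}"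
  let ?N = "\<lambda>\<sigma>. \<Sum>\<phi> | \<phi> permutes {..<?m}. \<Prod>j<?m. of_bool (cell n \<sigma> (\<phi> j) = (j mod n, j mod n)) :: int"
  have id: "?id \<in> perm_families n r" by (simp add: perm_families_def permutes_id)
  have "?N \<sigma> = 0" if \<sigma>: "\<sigma> \<in> perm_families n r" "\<sigma> \<noteq> ?id" for \<sigma>
  proof (rule sum.neutral, rule ballI, rule ccontr)
    fix \<phi> assume "\<phi> \<in> {\<phi>. \<phi> permutes {..<?m}}"
      and "(\<Prod>j<?m. of_bool (cell n \<sigma> (\<phi> j) = (j mod n, j mod n))) \<noteq> (0::int)"
    then have \<phi>: "\<phi> permutes {..<?m}" and eq: "\<And>j. j < ?m \<Longrightarrow> cell n \<sigma> (\<phi> j) = (j mod n, j mod n)"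
      by auto
    have "\<sigma> q = id" if q: "q < r" for q
    proof -
      have "\<sigma> q a = a" if a: "a < n" for a
      proof -
        have "q * n + a < Suc q * n" using a by simp
        also have "\<dots> \<le> ?m" using q by (intro mult_le_mono1) simp
        finally have "q * n + a < ?m" .
        then obtain j where j: "j < ?m" "\<phi> j = q * n + a"
          using permutes_image[OF \<phi>] by (metis imageE lessThan_iff)
        from eq[OF j(1)] show ?thesis using a j(2) by (auto simp: cell_def)
      qed
      moreover have "\<sigma> q permutes {..<n}" using \<sigma>(1) q by (auto simp: perm_families_def)
      ultimately show ?thesis by (metis eq_id_iff lessThan_iff permutes_not_in)
    qed
    then have "\<sigma> = ?id"
      using \<sigma>(1) id unfolding perm_families_def by (intro PiE_ext) auto
    then show False using \<sigma>(2) by simp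
  qed
  then have "omega_coeff n r (\<lambda>j. (j mod n, j mod n)) = (\<Sum>\<sigma>\<in>{?id}. family_sign r \<sigma> * ?N \<sigma>)"
    unfolding omega_coeff_alt using id by (intro sum.mono_neutral_right) auto
  also have "\<dots> = ?N ?id" by (simp add: family_sign_def)
  also have "\<dots> > 0"
  proof (rule sum_pos2[of _ id])
    show "0 < (\<Prod>j<?m. of_bool (cell n ?id (id j) = (j mod n, j mod n)) :: int)"
      by (intro prod_pos) (auto simp: cell_def less_mult_imp_div_less)
  qed (auto simp: finite_permutations permutes_id intro: prod_nonneg)
  finally show ?thesis .
qed

text \<open>A determinant alternates: when \<open>\<phi>\<close> puts \<open>u\<close> and
  \<open>v\<close> into the same block, exchanging their column indices amounts to composing the
  permutation of that block with a transposition of the two rows. This \<open>flip\<close> is an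
  involution on the families and negates the sign.\<close>

lemma matching_sign_transpose:
  assumes "n > 0" and \<phi>: "\<phi> permutes {..<r * n}" and uv: "u < r * n" "v < r * n" "u \<noteq> v"
    and same: "\<phi> u div n = \<phi> v div n"
  shows "matching_sign n r \<phi> (\<lambda>j. (a j, b (transpose u v j))) = - matching_sign n r \<phi> (\<lambda>j. (a j, b j))"
proof -
  let ?m = "r * n" and ?\<tau> = "transpose u v"
  let ?q = "\<phi> u div n"
  let ?t = "transpose (\<phi> u mod n) (\<phi> v mod n)"
  define flip where "flip \<sigma> = \<sigma>(?q := \<sigma> ?q \<circ> ?t)" for \<sigma> :: "nat \<Rightarrow> nat \<Rightarrow> nat"
  define F where "F \<sigma> = family_sign r \<sigma> * (\<Prod>j<?m. of_bool (cell n \<sigma> (\<phi> j) = (a j, b j)))" for \<sigma>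
  have \<tau>: "?\<tau> permutes {..<?m}" using uv by (simp add: permutes_swap_id)
  have \<phi>_lt: "\<phi> j < ?m" if "j < ?m" for j using permutes_in_image[OF \<phi>, of j] that by simp
  have q: "?q < r" using \<phi>_lt[OF uv(1)] by (simp add: less_mult_imp_div_less)
  have t: "?t permutes {..<n}" using \<open>n > 0\<close> by (simp add: permutes_swap_id)
  have \<phi>_eq: "j = k" if "\<phi> j div n = \<phi> k div n" "\<phi> j mod n = \<phi> k mod n" for j k
    using that permutes_inj[OF \<phi>] by (metis div_mult_mod_eq injD)
  have neq: "\<phi> u mod n \<noteq> \<phi> v mod n" using \<phi>_eq[of u v] same uv(3) by blast
  have flip_in: "flip \<sigma> \<in> perm_families n r" if "\<sigma> \<in> perm_families n r" for \<sigma>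
    using that q t unfolding flip_def perm_families_def
    by (auto simp: PiE_iff extensional_def intro!: permutes_compose)
  have flip_flip: "flip (flip \<sigma>) = \<sigma>" for \<sigma>
    by (simp add: flip_def comp_assoc)
  have sign_flip: "family_sign r (flip \<sigma>) = - family_sign r \<sigma>" if "\<sigma> \<in> perm_families n r" for \<sigma>
  proof -
    have "\<sigma> ?q permutes {..<n}" using that q by (auto simp: perm_families_def)
    then have "sign (\<sigma> ?q \<circ> ?t) = - sign (\<sigma> ?q)"
      using t neq by (subst sign_compose) (auto simp: permutation_permutes sign_swap_id intro: finite_lessThan)
    moreover have "family_sign r \<sigma>' = sign (\<sigma>' ?q) * (\<Prod>p\<in>{..<r} - {?q}. sign (\<sigma>' p))" for \<sigma>'
      unfolding family_sign_def using q by (subst prod.remove[of _ ?q]) auto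
    ultimately show ?thesis by (simp add: flip_def)
  qed
  have "family_sign r \<sigma> * (\<Prod>j<?m. of_bool (cell n \<sigma> (\<phi> j) = (a j, b (?\<tau> j)))) = - F (flip \<sigma>)"
    if \<sigma>: "\<sigma> \<in> perm_families n r" for \<sigma>
  proof -
    \<comment> \<open>At the cell of position \<open>j\<close>, \<open>flip \<sigma>\<close> has the
      column that \<open>\<sigma>\<close> has at the cell of position
      \<open>?\<tau> j\<close>.\<close>
    have *: "flip \<sigma> (\<phi> j div n) (\<phi> j mod n) = \<sigma> (\<phi> (?\<tau> j) div n) (\<phi> (?\<tau> j) mod n)" for j
    proof -
      consider "j = u" | "j = v" | "j \<noteq> u" "j \<noteq> v" by blast
      then show ?thesis
      proof cases
        case 3
        then have "\<phi> j mod n \<noteq> \<phi> u mod n \<and> \<phi> j mod n \<noteq> \<phi> v mod n" if "\<phi> j div n = ?q"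
          using that \<phi>_eq[of j u] \<phi>_eq[of j v] same by auto
        then show ?thesis using 3 by (auto simp: flip_def transpose_def)
      qed (use same in \<open>auto simp: flip_def transpose_def\<close>)
    qed
    have "(\<Prod>j<?m. of_bool (cell n \<sigma> (\<phi> j) = (a j, b (?\<tau> j)))) =
        (\<Prod>j<?m. of_bool (\<phi> j mod n = a j)) *
        (\<Prod>j<?m. of_bool (\<sigma> (\<phi> j div n) (\<phi> j mod n) = b (?\<tau> j)) :: int)"
      by (simp add: cell_def of_bool_conj prod.distrib)
    also have "(\<Prod>j<?m. of_bool (\<sigma> (\<phi> j div n) (\<phi> j mod n) = b (?\<tau> j)) :: int) =
        (\<Prod>j<?m. of_bool (flip \<sigma> (\<phi> j div n) (\<phi> j mod n) = b j))"
      by (subst prod.permute[OF \<tau>]) (simp add: *)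
    also have "(\<Prod>j<?m. of_bool (\<phi> j mod n = a j)) * \<dots> =
        (\<Prod>j<?m. of_bool (cell n (flip \<sigma>) (\<phi> j) = (a j, b j)))"
      by (simp add: cell_def of_bool_conj prod.distrib)
    finally show ?thesis by (simp add: F_def sign_flip[OF \<sigma>])
  qed
  then have "matching_sign n r \<phi> (\<lambda>j. (a j, b (?\<tau> j))) = - (\<Sum>\<sigma>\<in>perm_families n r. F (flip \<sigma>))"
    by (simp add: matching_sign_def sum_negf)
  also have "(\<Sum>\<sigma>\<in>perm_families n r. F (flip \<sigma>)) = (\<Sum>\<sigma>\<in>perm_families n r. F \<sigma>)"
    by (rule sum.reindex_bij_witness[where i=flip and j=flip]) (auto simp: flip_in flip_flip)
  finally show ?thesis by (simp add: matching_sign_def F_def)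
qed

text \<open>By Glynn's formula, \<open>\<Omega>\<^sup>r\<close> acts on forms of degree \<open>rn\<close>, up to a constant
  factor, as a weighted sum of point evaluations, so that no derivatives are needed.\<close>

definition sample_space :: "nat \<Rightarrow> nat \<Rightarrow> ((nat \<Rightarrow> nat \<Rightarrow> nat) \<times> (nat \<Rightarrow> complex)) set" where
  "sample_space n r = perm_families n r \<times> signs (r * n)"

definition sample_weight :: "nat \<Rightarrow> nat \<Rightarrow> (nat \<Rightarrow> nat \<Rightarrow> nat) \<times> (nat \<Rightarrow> complex) \<Rightarrow> complex" where
  "sample_weight n r c = of_int (family_sign r (fst c)) * (\<Prod>j<r * n. snd c j)"

text \<open>A signed sum of matrix units. Its entries are the linear forms in the signs to which
  Glynn's formula applies.\<close>

definition sample_mat :: "nat \<Rightarrow> nat \<Rightarrow> (nat \<Rightarrow> nat \<Rightarrow> nat) \<times> (nat \<Rightarrow> complex) \<Rightarrow> complex mat" where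
  "sample_mat n r c = mat n n (\<lambda>e. \<Sum>j<r * n. snd c j * of_bool (cell n (fst c) j = e))"

lemma sample_mat_carrier [simp]: "sample_mat n r c \<in> carrier_mat n n"
  by (simp add: sample_mat_def)

lemma finite_sample_space [simp]: "finite (sample_space n r)"
  by (simp add: sample_space_def)

text \<open>For a fixed family, Glynn's formula turns the sum over signs into
  \<open>2 ^ (r * n)\<close> times the permanent of the incidence matrix between its cells and the
  entries \<open>w j\<close>, which counts their matchings.\<close>

lemma sum_sample_monomial:
  assumes "\<And>j. j < r * n \<Longrightarrow> fst (w j) < n \<and> snd (w j) < n"
  shows "(\<Sum>c\<in>sample_space n r. sample_weight n r c * (\<Prod>j<r * n. sample_mat n r c $$ w j)) =
    2 ^ (r * n) * of_int (omega_coeff n r w)"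
proof -
  have "sample_mat n r c $$ w j = (\<Sum>i<r * n. snd c i * of_bool (cell n (fst c) i = w j))"
    if "j < r * n" for c j
    using assms[OF that] by (cases "w j") (simp add: sample_mat_def)
  then have "(\<Sum>c\<in>sample_space n r. sample_weight n r c * (\<Prod>j<r * n. sample_mat n r c $$ w j)) =
      (\<Sum>\<sigma>\<in>perm_families n r. of_int (family_sign r \<sigma>) * (\<Sum>s\<in>signs (r * n).
        (\<Prod>j<r * n. s j) * (\<Prod>j<r * n. \<Sum>i<r * n. s i * of_bool (cell n \<sigma> i = w j))))"
    by (simp add: sample_space_def sample_weight_def sum.cartesian_product' sum_distrib_left mult.assoc)
  also have "\<dots> = 2 ^ (r * n) * of_int (omega_coeff n r w)"
    unfolding sum_signs_prod_sum omega_coeff_alt by (simp add: sum_distrib_left mult.left_commute)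
  finally show ?thesis .
qed

text \<open>Expanding the power of the determinant into monomials and sampling each gives a positive
  multiple of the sum of squares in \<open>sum_family_sign_omega_coeff\<close>, where the diagonal
  word of \<open>omega_coeff_diag\<close> has a nonzero square.\<close>

lemma sum_sample_det_power:
  assumes "n > 0"
  shows "(\<Sum>c\<in>sample_space n r. sample_weight n r c * det (sample_mat n r c) ^ r) \<noteq> 0"
proof -
  let ?S = "\<Sum>\<rho>\<in>perm_families n r. family_sign r \<rho> * omega_coeff n r (cell n \<rho>)"
  let ?W = "{..<r * n} \<rightarrow>\<^sub>E ({..<n} \<times> {..<n})"
  let ?w = "restrict (\<lambda>j. (j mod n, j mod n)) {..<r * n}"
  have "(\<Sum>c\<in>sample_space n r. sample_weight n r c * det (sample_mat n r c) ^ r) =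
      (\<Sum>\<rho>\<in>perm_families n r. of_int (family_sign r \<rho>) *
        (\<Sum>c\<in>sample_space n r. sample_weight n r c * (\<Prod>j<r * n. sample_mat n r c $$ cell n \<rho> j)))"
    unfolding det_power_eq[OF sample_mat_carrier] sum_distrib_left
    by (subst sum.swap) (simp only: mult.left_commute)
  also have "\<dots> = 2 ^ (r * n) * of_int ?S"
    using cell_bounds[OF _ assms]
    by (simp add: sum_sample_monomial sum_distrib_left mult.left_commute)
  finally have eq: "(\<Sum>c\<in>sample_space n r. sample_weight n r c * det (sample_mat n r c) ^ r) =
      2 ^ (r * n) * of_int ?S" .
  have "omega_coeff n r ?w = omega_coeff n r (\<lambda>j. (j mod n, j mod n))"
    by (rule omega_coeff_cong) simp
  then have "omega_coeff n r ?w > 0" using omega_coeff_diag[OF assms] by simp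
  moreover have "?w \<in> ?W" using assms by auto
  ultimately have "(\<Sum>w\<in>?W. (omega_coeff n r w)\<^sup>2) > 0"
    by (intro sum_pos2[of _ ?w]) (auto simp: finite_PiE)
  then have "?S \<noteq> 0" using sum_family_sign_omega_coeff[OF assms, of r] by auto
  then have "(of_int ?S :: complex) \<noteq> 0" by (simp only: of_int_eq_0_iff) simp
  then show ?thesis unfolding eq by simp
qed

text \<open>Two positions \<open>u\<close> and \<open>v\<close> share their block in every factor by the pigeonhole principle. Swapping
  \<open>J u\<close> and \<open>J v\<close> changes the sign of a summand once for each of the oddly many factors.\<close>

lemma sum_product_swap_zero:
  fixes r :: "nat \<Rightarrow> nat" and T :: tensor
  assumes "odd (length ns)" and pos: "\<forall>n\<in>set ns. n > 0"
    and r: "\<And>k. k < length ns \<Longrightarrow> r k * ns ! k = m" and less: "(\<Prod>k<length ns. r k) < m"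
    and \<Phi>: "\<And>k. k < length ns \<Longrightarrow> \<Phi> k permutes {..<m}"
  shows "(\<Sum>J\<in>{..<m} \<rightarrow>\<^sub>E multi_indices ns. (\<Prod>j<m. T (J j)) *
    (\<Prod>k<length ns. of_int (matching_sign (ns ! k) (r k) (\<Phi> k) (\<lambda>j. (a k j, J j ! k))))) = (0 :: complex)"
proof -
  let ?d = "length ns" and ?V = "multi_indices ns"
  \<comment> \<open>\<open>?h j\<close> records the block containing \<open>\<Phi> k j\<close> for
    every factor \<open>k\<close>; the number of possible records is the product of the
    \<open>r k\<close>, less than the number \<open>m\<close> of positions.\<close>
  let ?h = "\<lambda>j. restrict (\<lambda>k. \<Phi> k j div ns ! k) {..<?d}"
  have "?h ` {..<m} \<subseteq> (\<Pi>\<^sub>E k\<in>{..<?d}. {..<r k})"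
  proof (intro image_subsetI, rule restrict_PiE_iff[THEN iffD2], rule ballI)
    fix j k assume j: "j \<in> {..<m}" and k: "k \<in> {..<?d}"
    then have "\<Phi> k j < r k * ns ! k" using permutes_in_image[OF \<Phi>, of k j] r by simp
    then show "\<Phi> k j div ns ! k \<in> {..<r k}" by (simp add: less_mult_imp_div_less)
  qed
  then have "card (?h ` {..<m}) \<le> card (\<Pi>\<^sub>E k\<in>{..<?d}. {..<r k})"
    by (intro card_mono) (auto simp: finite_PiE)
  also have "\<dots> < card {..<m}" using less by (simp add: card_PiE)
  finally have "\<not> inj_on ?h {..<m}" by (rule pigeonhole)
  then obtain u v where uv: "u < m" "v < m" "u \<noteq> v" "?h u = ?h v" by (auto simp: inj_on_def)
  have same: "\<Phi> k u div ns ! k = \<Phi> k v div ns ! k" if "k < ?d" for k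
    using fun_cong[OF uv(4), of k] that by simp
  let ?\<tau> = "transpose u v"
  have \<tau>: "?\<tau> permutes {..<m}" using uv by (simp add: permutes_swap_id)
  define G where "G J = (\<Prod>j<m. T (J j)) *
    (\<Prod>k<?d. of_int (matching_sign (ns ! k) (r k) (\<Phi> k) (\<lambda>j. (a k j, J j ! k))) :: complex)" for J
  have "G (J \<circ> ?\<tau>) = - G J" for J
  proof -
    have "(\<Prod>j<m. T ((J \<circ> ?\<tau>) j)) = (\<Prod>j<m. T (J j))"
      using prod.permute[OF \<tau>, of "\<lambda>j. T (J j)"] by (simp add: comp_def)
    moreover have "matching_sign (ns ! k) (r k) (\<Phi> k) (\<lambda>j. (a k j, J (?\<tau> j) ! k)) =
        - matching_sign (ns ! k) (r k) (\<Phi> k) (\<lambda>j. (a k j, J j ! k))" if k: "k < ?d" for k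
      using matching_sign_transpose[of "ns ! k" "\<Phi> k" "r k" u v "a k" "\<lambda>j. J j ! k"]
        pos k \<Phi>[OF k] r[OF k] uv same[OF k] by simp
    ultimately show ?thesis
      using \<open>odd (length ns)\<close> by (simp add: G_def prod_uminus)
  qed
  then have "(\<Sum>J\<in>{..<m} \<rightarrow>\<^sub>E ?V. G (J \<circ> ?\<tau>)) = - (\<Sum>J\<in>{..<m} \<rightarrow>\<^sub>E ?V. G J)"
    by (simp add: sum_negf)
  \<comment> \<open>Composition with the transposition permutes the index set, so the sum equals its
    own negative.\<close>
  moreover have "(\<Sum>J\<in>{..<m} \<rightarrow>\<^sub>E ?V. G (J \<circ> ?\<tau>)) = (\<Sum>J\<in>{..<m} \<rightarrow>\<^sub>E ?V. G J)"
  proof (rule sum.reindex_bij_witness[where i="\<lambda>J. J \<circ> ?\<tau>" and j="\<lambda>J. J \<circ> ?\<tau>"])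
    fix J assume J: "J \<in> {..<m} \<rightarrow>\<^sub>E ?V"
    show "J \<circ> ?\<tau> \<in> {..<m} \<rightarrow>\<^sub>E ?V"
    proof (rule PiE_I)
      fix j assume "j \<in> {..<m}"
      then have "?\<tau> j \<in> {..<m}" using permutes_in_image[OF \<tau>] by blast
      then show "(J \<circ> ?\<tau>) j \<in> ?V" using J by auto
    next
      fix j assume "j \<notin> {..<m}"
      then show "(J \<circ> ?\<tau>) j = undefined"
        using J permutes_not_in[OF \<tau>, of j] PiE_arb[OF J, of j] by simp
    qed
    then show "J \<circ> ?\<tau> \<in> {..<m} \<rightarrow>\<^sub>E ?V" .
  qed (simp_all add: comp_assoc)
  ultimately have "(\<Sum>J\<in>{..<m} \<rightarrow>\<^sub>E ?V. G J) = 0" by simp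
  then show ?thesis by (simp add: G_def)
qed

text \<open>By linearity one monomial suffices. Its sampled sum becomes a sum over one matching
  \<open>\<Phi> k\<close> per factor; with the matchings fixed, the sum over the index families
  \<open>J\<close> vanishes by \<open>sum_product_swap_zero\<close>.\<close>

lemma sum_sample_form_zero:
  fixes r :: "nat \<Rightarrow> nat"
  assumes "odd (length ns)" and pos: "\<forall>n\<in>set ns. n > 0"
    and r: "\<And>k. k < length ns \<Longrightarrow> r k * ns ! k = m" and less: "(\<Prod>k<length ns. r k) < m"
    and f: "form m (multi_indices ns) f"
  shows "(\<Sum>c\<in>(\<Pi>\<^sub>E k\<in>{..<length ns}. sample_space (ns ! k) (r k)).
    (\<Prod>k<length ns. sample_weight (ns ! k) (r k) (c k)) *
    f (tensor_act ns (map (\<lambda>k. sample_mat (ns ! k) (r k) (c k)) [0..<length ns]) T)) = 0"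
  using f
proof (induction rule: form.induct)
  case zero
  show ?case by simp
next
  case (add_monomial f xs b)
  let ?d = "length ns" and ?V = "multi_indices ns"
  let ?C = "\<Pi>\<^sub>E k\<in>{..<?d}. sample_space (ns ! k) (r k)"
  let ?P = "\<Pi>\<^sub>E k\<in>{..<?d}. {\<phi>. \<phi> permutes {..<m}}"
  define gs where "gs c = map (\<lambda>k. sample_mat (ns ! k) (r k) (c k)) [0..<?d]" for c
  define wt where "wt c = (\<Prod>k<?d. sample_weight (ns ! k) (r k) (c k))" for c
  define S where "S c k e = sample_mat (ns ! k) (r k) c $$ e" for c k e
  have bound: "is ! k < ns ! k" if "is \<in> ?V" "k < ?d" for "is" k
    using that by (auto simp: multi_indices_def list_all2_conv_all_nth)
  have xsV: "xs ! j \<in> ?V" if "j < m" for j using that add_monomial.hyps nth_mem by blast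
  have coeff: "act_coeff ns (gs c) x y = (\<Prod>k<?d. S (c k) k (x ! k, y ! k))" for c x y
    by (simp add: act_coeff_def gs_def S_def)
  \<comment> \<open>\<open>J j\<close> is the index of the entry of \<open>T\<close> used by letter
    \<open>j\<close> of the monomial.\<close>
  have mono: "prod_list (map (tensor_act ns (gs c) T) xs) = (\<Sum>J\<in>{..<m} \<rightarrow>\<^sub>E ?V.
      (\<Prod>j<m. T (J j)) * (\<Prod>k<?d. \<Prod>j<m. S (c k) k (xs ! j ! k, J j ! k)))" for c
  proof -
    have "prod_list (map (tensor_act ns (gs c) T) xs) =
        (\<Prod>j<m. \<Sum>y\<in>?V. act_coeff ns (gs c) (xs ! j) y * T y)"
      using add_monomial.hyps xsV by (simp add: prod_list_map_nth tensor_act_eq)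
    also have "\<dots> = (\<Sum>J\<in>{..<m} \<rightarrow>\<^sub>E ?V. \<Prod>j<m. act_coeff ns (gs c) (xs ! j) (J j) * T (J j))"
      by (rule prod_sum_PiE) (auto simp: finite_multi_indices)
    also have "\<dots> = (\<Sum>J\<in>{..<m} \<rightarrow>\<^sub>E ?V.
        (\<Prod>j<m. T (J j)) * (\<Prod>k<?d. \<Prod>j<m. S (c k) k (xs ! j ! k, J j ! k)))"
      unfolding coeff prod.distrib by (subst prod.swap) (simp add: mult.commute)
    finally show ?thesis .
  qed
  \<comment> \<open>Weights and entries for factor \<open>k\<close> depend only on
    \<open>c k\<close>, so the sum over \<open>?C\<close> is a product of sums over single sample
    spaces, each evaluated by \<open>sum_sample_monomial\<close>.\<close>
  have expand: "(\<Sum>c\<in>?C. wt c * (\<Prod>k<?d. \<Prod>j<m. S (c k) k (xs ! j ! k, J j ! k))) =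
      (\<Sum>\<Phi>\<in>?P. 2 ^ (m * ?d) *
        (\<Prod>k<?d. of_int (matching_sign (ns ! k) (r k) (\<Phi> k) (\<lambda>j. (xs ! j ! k, J j ! k)))))"
    if J: "J \<in> {..<m} \<rightarrow>\<^sub>E ?V" for J
  proof -
    have "(\<Sum>c\<in>?C. wt c * (\<Prod>k<?d. \<Prod>j<m. S (c k) k (xs ! j ! k, J j ! k))) =
        (\<Sum>c\<in>?C. \<Prod>k<?d. sample_weight (ns ! k) (r k) (c k) *
          (\<Prod>j<m. S (c k) k (xs ! j ! k, J j ! k)))"
      by (simp add: wt_def prod.distrib)
    also have "\<dots> = (\<Prod>k<?d. \<Sum>c\<in>sample_space (ns ! k) (r k). sample_weight (ns ! k) (r k) c *
          (\<Prod>j<m. S c k (xs ! j ! k, J j ! k)))"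
      by (rule prod_sum_PiE[symmetric]) auto
    also have "\<dots> = (\<Prod>k<?d. 2 ^ m * of_int (omega_coeff (ns ! k) (r k) (\<lambda>j. (xs ! j ! k, J j ! k))))"
    proof (rule prod.cong)
      fix k assume "k \<in> {..<?d}"
      then have k: "k < ?d" by simp
      have "J j \<in> ?V" if "j < m" for j using J that by auto
      then show "(\<Sum>c\<in>sample_space (ns ! k) (r k). sample_weight (ns ! k) (r k) c *
          (\<Prod>j<m. S c k (xs ! j ! k, J j ! k))) =
          2 ^ m * of_int (omega_coeff (ns ! k) (r k) (\<lambda>j. (xs ! j ! k, J j ! k)))"
        using sum_sample_monomial[of "r k" "ns ! k" "\<lambda>j. (xs ! j ! k, J j ! k)"]
          bound[OF _ k] xsV r[OF k] by (simp add: S_def)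
    qed simp
    also have "\<dots> = (\<Prod>k<?d. \<Sum>\<phi>\<in>{\<phi>. \<phi> permutes {..<m}}.
        2 ^ m * of_int (matching_sign (ns ! k) (r k) \<phi> (\<lambda>j. (xs ! j ! k, J j ! k))))"
      using r by (simp add: omega_coeff_def sum_distrib_left)
    also have "\<dots> = (\<Sum>\<Phi>\<in>?P. \<Prod>k<?d.
        2 ^ m * of_int (matching_sign (ns ! k) (r k) (\<Phi> k) (\<lambda>j. (xs ! j ! k, J j ! k))))"
      by (rule prod_sum_PiE) (auto simp: finite_permutations)
    also have "\<dots> = (\<Sum>\<Phi>\<in>?P. 2 ^ (m * ?d) *
        (\<Prod>k<?d. of_int (matching_sign (ns ! k) (r k) (\<Phi> k) (\<lambda>j. (xs ! j ! k, J j ! k)))))"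
      by (simp add: prod.distrib power_mult)
    finally show ?thesis .
  qed
  have "(\<Sum>c\<in>?C. wt c * prod_list (map (tensor_act ns (gs c) T) xs)) =
      (\<Sum>J\<in>{..<m} \<rightarrow>\<^sub>E ?V. (\<Prod>j<m. T (J j)) *
        (\<Sum>c\<in>?C. wt c * (\<Prod>k<?d. \<Prod>j<m. S (c k) k (xs ! j ! k, J j ! k))))"
    unfolding mono sum_distrib_left by (subst sum.swap) (simp only: mult.left_commute)
  also have "\<dots> = (\<Sum>J\<in>{..<m} \<rightarrow>\<^sub>E ?V. \<Sum>\<Phi>\<in>?P. 2 ^ (m * ?d) * ((\<Prod>j<m. T (J j)) *
        (\<Prod>k<?d. of_int (matching_sign (ns ! k) (r k) (\<Phi> k) (\<lambda>j. (xs ! j ! k, J j ! k))))))"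
    by (intro sum.cong refl) (simp only: expand sum_distrib_left mult.left_commute)
  also have "\<dots> = (\<Sum>\<Phi>\<in>?P. 2 ^ (m * ?d) * (\<Sum>J\<in>{..<m} \<rightarrow>\<^sub>E ?V. (\<Prod>j<m. T (J j)) *
        (\<Prod>k<?d. of_int (matching_sign (ns ! k) (r k) (\<Phi> k) (\<lambda>j. (xs ! j ! k, J j ! k))))))"
    by (subst sum.swap) (simp only: sum_distrib_left)
  also have "\<dots> = 0"
  proof (intro sum.neutral ballI)
    fix \<Phi> assume \<Phi>: "\<Phi> \<in> ?P"
    have "(\<Sum>J\<in>{..<m} \<rightarrow>\<^sub>E ?V. (\<Prod>j<m. T (J j)) *
        (\<Prod>k<?d. of_int (matching_sign (ns ! k) (r k) (\<Phi> k) (\<lambda>j. (xs ! j ! k, J j ! k))))) = 0"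
      by (rule sum_product_swap_zero[OF assms(1) pos r less]) (use \<Phi> in auto)
    then show "2 ^ (m * ?d) * (\<Sum>J\<in>{..<m} \<rightarrow>\<^sub>E ?V. (\<Prod>j<m. T (J j)) *
        (\<Prod>k<?d. of_int (matching_sign (ns ! k) (r k) (\<Phi> k) (\<lambda>j. (xs ! j ! k, J j ! k))))) = 0"
      by simp
  qed
  finally have zero: "(\<Sum>c\<in>?C. wt c * prod_list (map (tensor_act ns (gs c) T) xs)) = 0" .
  have "(\<Sum>c\<in>?C. wt c * (b * prod_list (map (tensor_act ns (gs c) T) xs) + f (tensor_act ns (gs c) T))) =
      b * (\<Sum>c\<in>?C. wt c * prod_list (map (tensor_act ns (gs c) T) xs)) +
      (\<Sum>c\<in>?C. wt c * f (tensor_act ns (gs c) T))"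
    by (simp add: distrib_left sum.distrib sum_distrib_left mult.left_commute)
  then show ?case using zero add_monomial.IH by (simp add: wt_def gs_def)
qed

section \<open>Action of arbitrary matrices and the lower bound\<close>

lemma tensor_act_scaled:
  assumes "length gs = length ns" "\<And>k. k < length ns \<Longrightarrow> gs ! k \<in> carrier_mat (ns ! k) (ns ! k)"
  shows "tensor_act ns (map (\<lambda>k. c k \<cdot>\<^sub>m gs ! k) [0..<length ns]) T =
    (\<lambda>is. (\<Prod>k<length ns. c k) * tensor_act ns gs T is)"
proof
  fix "is"
  have "act_coeff ns (map (\<lambda>k. c k \<cdot>\<^sub>m gs ! k) [0..<length ns]) is js =
      (\<Prod>k<length ns. c k) * act_coeff ns gs is js"
    if "is \<in> multi_indices ns" "js \<in> multi_indices ns" for js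
  proof -
    have "is ! k < ns ! k" "js ! k < ns ! k" if "k < length ns" for k
      using that \<open>is \<in> multi_indices ns\<close> \<open>js \<in> multi_indices ns\<close>
      by (auto simp: multi_indices_def list_all2_conv_all_nth)
    then have "map (\<lambda>k. c k \<cdot>\<^sub>m gs ! k) [0..<length ns] ! k $$ (is ! k, js ! k) =
        c k * gs ! k $$ (is ! k, js ! k)" if "k < length ns" for k
      using that carrier_matD[OF assms(2)[OF that]] by simp
    then show ?thesis by (simp add: act_coeff_def prod.distrib)
  qed
  then show "tensor_act ns (map (\<lambda>k. c k \<cdot>\<^sub>m gs ! k) [0..<length ns]) T is =
      (\<Prod>k<length ns. c k) * tensor_act ns gs T is"
    by (cases "is \<in> multi_indices ns")
      (simp_all add: tensor_act_eq sum_distrib_left mult.assoc, simp add: tensor_act_def)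
qed

lemma tensor_act_one:
  assumes "T \<in> tensor_space ns"
  shows "tensor_act ns (map (\<lambda>n. 1\<^sub>m n) ns) T = T"
proof
  fix "is"
  show "tensor_act ns (map (\<lambda>n. 1\<^sub>m n) ns) T is = T is"
  proof (cases "is \<in> multi_indices ns")
    case True
    have "act_coeff ns (map (\<lambda>n. 1\<^sub>m n) ns) is js = of_bool (js = is)" if "js \<in> multi_indices ns" for js
    proof -
      have bound: "is ! k < ns ! k" "js ! k < ns ! k" if "k < length ns" for k
        using that True \<open>js \<in> multi_indices ns\<close>
        by (auto simp: multi_indices_def list_all2_conv_all_nth)
      have "act_coeff ns (map (\<lambda>n. 1\<^sub>m n) ns) is js = (\<Prod>k<length ns. of_bool (js ! k = is ! k))"
        unfolding act_coeff_def by (intro prod.cong refl) (use bound in auto)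
      also have "\<dots> = of_bool (js = is)"
      proof (cases "js = is")
        case False
        then obtain k where "k < length ns" "js ! k \<noteq> is ! k"
          using length_multi_indices[OF True] length_multi_indices[OF \<open>js \<in> multi_indices ns\<close>]
          by (metis nth_equalityI)
        then show ?thesis using False by (auto intro: prod_zero)
      qed simp
      finally show ?thesis .
    qed
    then have "tensor_act ns (map (\<lambda>n. 1\<^sub>m n) ns) T is =
        (\<Sum>js\<in>multi_indices ns. if js = is then T js else 0)"
      unfolding tensor_act_eq[OF True] by (intro sum.cong) auto
    then show ?thesis using True by (simp add: finite_multi_indices)
  next
    case False
    then show ?thesis using assms by (simp add: tensor_act_def tensor_space_def)
  qed
qed

text \<open>A primitive root of unity of order \<open>ns ! k\<close> times the identity in slot
  \<open>k\<close> has determinant 1 and multiplies \<open>T\<close> by the root. Homogeneity then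
  makes the \<open>m\<close>-th power of the root equal to 1.\<close>

lemma invariant_form_degree_dvd:
  assumes f: "invariant_form ns m f" and k: "k < length ns" and pos: "ns ! k > 0"
  shows "ns ! k dvd m"
proof -
  let ?n = "ns ! k"
  define z where "z = cis (2 * pi / ?n)"
  define c where "c i = (if i = k then z else 1)" for i
  obtain T where T: "T \<in> tensor_space ns" "f T \<noteq> 0" using f by (auto simp: invariant_form_def)
  let ?gs = "map (\<lambda>i. c i \<cdot>\<^sub>m (map (\<lambda>n. 1\<^sub>m n) ns) ! i) [0..<length ns]"
  have "z ^ ?n = 1" using pos by (simp add: z_def DeMoivre)
  then have "?gs \<in> SL_prod ns"
    by (auto simp: SL_prod_def SL_def list_all2_conv_all_nth c_def)
  then have "f T = f (tensor_act ns ?gs T)" using f T(1) by (simp add: invariant_form_def)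
  also have "tensor_act ns ?gs T = (\<lambda>is. (\<Prod>i<length ns. c i) * T is)"
    by (subst tensor_act_scaled) (auto simp: tensor_act_one[OF T(1)])
  also have "(\<Prod>i<length ns. c i) = z" using k by (simp add: c_def)
  also have "f (\<lambda>is. z * T is) = z ^ m * f T"
    using f by (auto simp: invariant_form_def intro: form_scale)
  finally have "z ^ m = 1" using T(2) by simp
  \<comment> \<open>Comparing real parts turns \<open>z ^ m = 1\<close> into a statement about
    multiples of \<open>2 * pi\<close>.\<close>
  then have "cos (real m * (2 * pi / ?n)) = 1"
    by (simp add: z_def DeMoivre complex_eq_iff)
  then obtain i :: int where i: "real m * (2 * pi / ?n) = of_int i * 2 * pi"
    by (auto simp: cos_one_2pi_int)
  then have "real m = of_int i * real ?n" using pos by (simp add: field_simps)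
  then have "int m = i * int ?n" by (metis of_int_eq_iff of_int_mult of_int_of_nat_eq)
  then show ?thesis by (metis dvd_triv_right int_dvd_int_iff)
qed

lemma ex_complex_root:
  assumes "n > 0"
  shows "\<exists>z::complex. z ^ n = w"
proof
  show "rcis (root n (cmod w)) (Arg w / n) ^ n = w"
    using assms by (simp add: DeMoivre2 rcis_cmod_Arg)
qed

text \<open>Dividing each matrix by an \<open>ns ! k\<close>-th root \<open>z k\<close> of its
  determinant gives a tuple in \<open>SL_prod ns\<close>. Homogeneity extracts the scalars, and
  \<open>z k ^ m\<close> is the \<open>r k\<close>-th power of the determinant because
  \<open>m = r k * ns ! k\<close>.\<close>

lemma invariant_form_act_invertible:
  fixes r :: "nat \<Rightarrow> nat"
  assumes f: "invariant_form ns m f" and T: "T \<in> tensor_space ns"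
    and pos: "\<forall>n\<in>set ns. n > 0" and r: "\<And>k. k < length ns \<Longrightarrow> r k * ns ! k = m"
    and len: "length gs = length ns"
    and carrier: "\<And>k. k < length ns \<Longrightarrow> gs ! k \<in> carrier_mat (ns ! k) (ns ! k)"
    and nz: "\<And>k. k < length ns \<Longrightarrow> det (gs ! k) \<noteq> 0"
  shows "f (tensor_act ns gs T) = (\<Prod>k<length ns. det (gs ! k) ^ r k) * f T"
proof -
  have "\<forall>k\<in>{..<length ns}. \<exists>z::complex. z ^ (ns ! k) = det (gs ! k)"
    using pos by (auto intro!: ex_complex_root)
  then obtain z :: "nat \<Rightarrow> complex" where z: "\<And>k. k < length ns \<Longrightarrow> z k ^ (ns ! k) = det (gs ! k)"
    by (metis lessThan_iff)
  have z0: "z k \<noteq> 0" if "k < length ns" for k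
    using z[OF that] nz[OF that] bspec[OF pos nth_mem[OF that]] by (auto simp: power_0_left)
  let ?hs = "map (\<lambda>k. (1 / z k) \<cdot>\<^sub>m gs ! k) [0..<length ns]"
  have "?hs \<in> SL_prod ns"
  proof -
    have "det ((1 / z k) \<cdot>\<^sub>m gs ! k) = 1" if k: "k < length ns" for k
      using carrier[OF k] z[OF k] z0[OF k] nz[OF k] by (simp add: power_one_over)
    then show ?thesis
      using carrier by (auto simp: SL_prod_def SL_def list_all2_conv_all_nth)
  qed
  then have "f T = f (tensor_act ns ?hs T)" using f T by (simp add: invariant_form_def)
  also have "\<dots> = f (\<lambda>is. (\<Prod>k<length ns. 1 / z k) * tensor_act ns gs T is)"
    by (subst tensor_act_scaled[OF len carrier]) auto
  also have "\<dots> = (\<Prod>k<length ns. 1 / z k) ^ m * f (tensor_act ns gs T)"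
    using f by (auto simp: invariant_form_def intro: form_scale)
  also have "(\<Prod>k<length ns. 1 / z k) ^ m = (\<Prod>k<length ns. 1 / det (gs ! k) ^ r k)"
    unfolding prod_power_distrib
  proof (rule prod.cong)
    fix k assume "k \<in> {..<length ns}"
    then have k: "k < length ns" by simp
    have "(1 / z k) ^ m = 1 / (z k ^ ns ! k) ^ r k"
      by (simp add: r[OF k, symmetric] power_one_over power_mult[symmetric] mult.commute)
    then show "(1 / z k) ^ m = 1 / det (gs ! k) ^ r k" by (simp add: z[OF k])
  qed simp
  finally show ?thesis using nz by (simp add: prod_dividef field_simps)
qed

text \<open>The determinant vanishes only if \<open>- t\<close> is an eigenvalue of
  \<open>A\<close>, which excludes finitely many \<open>t\<close>.\<close>

lemma eventually_det_nonzero: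
  fixes A :: "complex mat"
  assumes A: "A \<in> carrier_mat n n"
  shows "\<forall>\<^sub>F t in at 0. det (A + t \<cdot>\<^sub>m 1\<^sub>m n) \<noteq> 0"
proof -
  let ?F = "uminus ` {e. poly (char_poly A) e = 0}"
  have "char_poly A \<noteq> 0" using degree_monic_char_poly[OF A] by auto
  then have "finite ?F" using poly_roots_finite by blast
  then have "\<forall>\<^sub>F t in at 0. \<forall>e\<in>?F. t \<noteq> e"
    by (intro eventually_ball_finite ballI) (simp_all add: eventually_neq_at_within)
  then show ?thesis
  proof eventually_elim
    case (elim t)
    have "t \<in> ?F" if "poly (char_poly A) (- t) = 0"
      using that by (intro image_eqI[of _ _ "- t"]) auto
    with elim have "poly (char_poly A) (- t) \<noteq> 0" by blast
    then show ?case
      using A by (simp add: eigenvalue_root_char_poly[OF A, symmetric] eigenvalue_det[OF A] char_matrix_def)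
  qed
qed

lemma tendsto_det:
  assumes "\<And>t. A t \<in> carrier_mat n n" "B \<in> carrier_mat n n"
    and "\<And>i j. i < n \<Longrightarrow> j < n \<Longrightarrow> ((\<lambda>t. A t $$ (i, j)) \<longlongrightarrow> B $$ (i, j)) F"
  shows "((\<lambda>t. det (A t)) \<longlongrightarrow> det (B :: complex mat)) F"
  unfolding det_def'[OF assms(1)] det_def'[OF assms(2)]
proof (intro tendsto_sum tendsto_mult tendsto_const tendsto_prod)
  fix p i assume "p \<in> {p. p permutes {0..<n}}" "i \<in> {0..<n}"
  then have "i < n" "p i < n" using permutes_in_image[of p "{0..<n}" i] by auto
  then show "((\<lambda>t. A t $$ (i, p i)) \<longlongrightarrow> B $$ (i, p i)) F" by (rule assms(3))
qed

text \<open>Singular matrices are limits of invertible ones.\<close>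

lemma invariant_form_act:
  fixes r :: "nat \<Rightarrow> nat"
  assumes f: "invariant_form ns m f" and T: "T \<in> tensor_space ns"
    and pos: "\<forall>n\<in>set ns. n > 0" and r: "\<And>k. k < length ns \<Longrightarrow> r k * ns ! k = m"
    and len: "length gs = length ns"
    and carrier: "\<And>k. k < length ns \<Longrightarrow> gs ! k \<in> carrier_mat (ns ! k) (ns ! k)"
  shows "f (tensor_act ns gs T) = (\<Prod>k<length ns. det (gs ! k) ^ r k) * f T"
proof -
  \<comment> \<open>One parameter \<open>t\<close> perturbs all slots; for small
    \<open>t \<noteq> 0\<close> they are all invertible.\<close>
  define G where "G t k = gs ! k + t \<cdot>\<^sub>m 1\<^sub>m (ns ! k)" for t k
  define hs where "hs t = map (G t) [0..<length ns]" for t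
  have G: "G t k \<in> carrier_mat (ns ! k) (ns ! k)" for t k by (simp add: G_def)
  have entry: "((\<lambda>t. G t k $$ (i, j)) \<longlongrightarrow> gs ! k $$ (i, j)) (at 0)"
    if "k < length ns" "i < ns ! k" "j < ns ! k" for k i j
    using that carrier[OF that(1)] unfolding G_def
    by (auto intro!: tendsto_eq_intros)
  have bound: "is ! k < ns ! k" if "is \<in> multi_indices ns" "k < length ns" for "is" k
    using that by (auto simp: multi_indices_def list_all2_conv_all_nth)
  have act: "((\<lambda>t. tensor_act ns (hs t) T is) \<longlongrightarrow> tensor_act ns gs T is) (at 0)" for "is"
  proof (cases "is \<in> multi_indices ns")
    case True
    have "((\<lambda>t. act_coeff ns (hs t) is js) \<longlongrightarrow> act_coeff ns gs is js) (at 0)"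
      if "js \<in> multi_indices ns" for js
      unfolding act_coeff_def hs_def
      using bound[OF True] bound[OF that] by (intro tendsto_prod) (auto intro: entry)
    then show ?thesis unfolding tensor_act_eq[OF True] by (intro tendsto_intros)
  next
    case False
    then show ?thesis by (simp add: tensor_act_def)
  qed
  have lim_left: "((\<lambda>t. f (tensor_act ns (hs t) T)) \<longlongrightarrow> f (tensor_act ns gs T)) (at 0)"
    using form_tendsto[of m "multi_indices ns" f "\<lambda>t. tensor_act ns (hs t) T", OF _ act] f
    by (simp add: invariant_form_def)
  have lim_right: "((\<lambda>t. (\<Prod>k<length ns. det (G t k) ^ r k) * f T) \<longlongrightarrow>
      (\<Prod>k<length ns. det (gs ! k) ^ r k) * f T) (at 0)"
  proof (rule tendsto_mult[OF tendsto_prod tendsto_const], rule tendsto_power)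
    fix k assume "k \<in> {..<length ns}"
    then show "((\<lambda>t. det (G t k)) \<longlongrightarrow> det (gs ! k)) (at 0)"
      using tendsto_det[of "\<lambda>t. G t k", OF G carrier entry] by simp
  qed
  have eq: "\<forall>\<^sub>F t in at 0. f (tensor_act ns (hs t) T) = (\<Prod>k<length ns. det (G t k) ^ r k) * f T"
  proof -
    have "\<forall>\<^sub>F t in at 0. \<forall>k\<in>{..<length ns}. det (G t k) \<noteq> 0"
      unfolding G_def using carrier
      by (intro eventually_ball_finite ballI eventually_det_nonzero) auto
    then show ?thesis
    proof eventually_elim
      case (elim t)
      then show ?case
        using invariant_form_act_invertible[OF f T pos r, of "hs t"] G by (simp add: hs_def)
    qed
  qed
  show ?thesis
    by (rule tendsto_unique[OF at_neq_bot tendsto_cong[OF eq, THEN iffD1, OF lim_left] lim_right])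
qed

text \<open>It suffices that \<open>m\<close> is at most the product of the
  \<open>r k = m div ns ! k\<close>: multiplying by the product of the dimensions gives
  \<open>m ^ length ns\<close> on the right, and one factor \<open>m\<close> cancels.\<close>

lemma prod_list_le_degree_power:
  assumes f: "invariant_form ns m f" and "m > 0" and odd: "odd (length ns)"
    and pos: "\<forall>n\<in>set ns. n > 0"
  shows "prod_list ns \<le> m ^ (length ns - 1)"
proof -
  let ?d = "length ns"
  define r where "r k = m div ns ! k" for k
  have r: "r k * ns ! k = m" if "k < ?d" for k
    using invariant_form_degree_dvd[OF f that] pos that by (simp add: r_def)
  obtain T where T: "T \<in> tensor_space ns" "f T \<noteq> 0" using f by (auto simp: invariant_form_def)
  have "m \<le> (\<Prod>k<?d. r k)"
  proof (rule ccontr)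
    assume "\<not> m \<le> (\<Prod>k<?d. r k)"
    then have less: "(\<Prod>k<?d. r k) < m" by simp
    let ?C = "\<Pi>\<^sub>E k\<in>{..<?d}. sample_space (ns ! k) (r k)"
    \<comment> \<open>The same weighted sum of values of \<open>f\<close> is 0 by
      \<open>sum_sample_form_zero\<close>, but by \<open>invariant_form_act\<close> it is
      \<open>f T\<close> times a product of factors that are nonzero by
      \<open>sum_sample_det_power\<close>.\<close>
    have "0 = (\<Sum>c\<in>?C. (\<Prod>k<?d. sample_weight (ns ! k) (r k) (c k)) *
        f (tensor_act ns (map (\<lambda>k. sample_mat (ns ! k) (r k) (c k)) [0..<?d]) T))"
      using f by (subst sum_sample_form_zero[OF odd pos r less]) (auto simp: invariant_form_def)
    also have "\<dots> = (\<Sum>c\<in>?C. (\<Prod>k<?d. sample_weight (ns ! k) (r k) (c k) *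
        det (sample_mat (ns ! k) (r k) (c k)) ^ r k)) * f T"
      by (subst invariant_form_act[OF f T(1) pos r]) (auto simp: prod.distrib sum_distrib_right mult.assoc)
    also have "(\<Sum>c\<in>?C. (\<Prod>k<?d. sample_weight (ns ! k) (r k) (c k) *
        det (sample_mat (ns ! k) (r k) (c k)) ^ r k)) =
        (\<Prod>k<?d. \<Sum>c\<in>sample_space (ns ! k) (r k). sample_weight (ns ! k) (r k) c *
          det (sample_mat (ns ! k) (r k) c) ^ r k)"
      by (rule prod_sum_PiE[symmetric]) auto
    finally show False
      using T(2) sum_sample_det_power pos by auto
  qed
  then have "m * prod_list ns \<le> (\<Prod>k<?d. r k) * prod_list ns" by (rule mult_le_mono1)
  also have "\<dots> = (\<Prod>k<?d. r k * ns ! k)"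
    by (simp add: prod.distrib prod.list_conv_set_nth atLeast0LessThan)
  also have "\<dots> = m ^ ?d" using r by simp
  also have "\<dots> = m * m ^ (?d - 1)" using odd by (metis odd_pos power_minus_mult mult.commute)
  finally show ?thesis using \<open>m > 0\<close> by simp
qed

lemma delta_ge:
  assumes "3 \<le> length ns" "odd (length ns)" "\<forall>n\<in>set ns. n > 0"
  shows "enat (nat \<lceil>real (prod_list ns) powr (1 / (real (length ns) - 1))\<rceil>) \<le> delta ns"
  unfolding delta_eq
proof (rule Inf_greatest)
  fix x assume "x \<in> {enat m |m. 0 < m \<and> (\<exists>f. invariant_form ns m f)}"
  then obtain m f where x: "x = enat m" and m: "0 < m" and f: "invariant_form ns m f" by blast
  let ?e = "real (length ns) - 1"
  \<comment> \<open>Natural and real subtraction agree since there are at least three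
    factors.\<close>
  have e: "?e = real (length ns - 1)" "?e > 0" using assms(1) by auto
  have "real (prod_list ns) \<le> real m ^ (length ns - 1)"
    using prod_list_le_degree_power[OF f m assms(2,3)] by (metis of_nat_le_iff of_nat_power)
  then have "real (prod_list ns) powr (1 / ?e) \<le> (real m ^ (length ns - 1)) powr (1 / ?e)"
    using e by (intro powr_mono2) auto
  also have "\<dots> = real m"
    using m e by (simp add: powr_realpow[symmetric] powr_powr)
  \<comment> \<open>As \<open>m\<close> is an integer, the bound passes to the ceiling.\<close>
  finally show "enat (nat \<lceil>real (prod_list ns) powr (1 / ?e)\<rceil>) \<le> x"
    unfolding x by (simp add: ceiling_le_iff nat_le_iff)
qed

theorem theorem4p1:
  shows "(\<forall>(d::nat) (ns::nat list).
            d \<ge> 3 \<and> odd d \<and> length ns = d \<and> (\<forall>n\<in>set ns. n > 0) \<longrightarrow>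
            delta ns \<ge> enat (nat \<lceil>real (prod_list ns) powr (1 / (real d - 1))\<rceil>))
       \<and> (\<forall>(d::nat) (l::nat) (ns::nat list).
            d > 3 \<and> l \<in> {2..d - 2} \<and> length ns = d \<and> (\<forall>n\<in>set ns. n > 0) \<and>
            delta (take l ns) \<noteq> \<infinity> \<and> delta (drop l ns) \<noteq> \<infinity> \<longrightarrow>
            delta ns \<le> enat (lcm (the_enat (delta (take l ns))) (the_enat (delta (drop l ns)))))"
proof (intro conjI allI impI)
  fix d :: nat and ns :: "nat list"
  assume "d \<ge> 3 \<and> odd d \<and> length ns = d \<and> (\<forall>n\<in>set ns. n > 0)"
  then show "delta ns \<ge> enat (nat \<lceil>real (prod_list ns) powr (1 / (real d - 1))\<rceil>)"
    using delta_ge[of ns] by blast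
next
  fix d l :: nat and ns :: "nat list"
  assume "d > 3 \<and> l \<in> {2..d - 2} \<and> length ns = d \<and> (\<forall>n\<in>set ns. n > 0) \<and>
    delta (take l ns) \<noteq> \<infinity> \<and> delta (drop l ns) \<noteq> \<infinity>"
  then show "delta ns \<le> enat (lcm (the_enat (delta (take l ns))) (the_enat (delta (drop l ns))))"
    using delta_append_le[of "take l ns" "drop l ns"] by simp
qed

end
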